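(* Let $K$ be a commutative ring and $n\ge4$. Then the Jacobian group $\Sigma$ is not a normal subgroup of $\Gamma$ if and only if $n\ge5$.
   Context: Rings are associative with $1$. $\Lambda_n=\Lambda_n(K)$ is the Grassmann $K$-algebra generated freely over $K$ by $x_1,\dots,x_n$ subject to $x_i^2=0$, $x_ix_j=-x_jx_i$ ($i\ne j$); it is graded by total degree with components $\Lambda_{n,d}$; $\mathfrak m=\bigoplus_{d\ge1}\Lambda_{n,d}$; $\Lambda_n^{od}$ is the sum of the odd degree components. $\Gamma$ is the group of $K$-algebra automorphisms $\sigma$ of $\Lambda_n$ with $\sigma(x_i)-x_i\in\Lambda_n^{od}\cap\mathfrak m^3$ for all $i$. The left skew derivation $\partial/\partial x_j$ is the $K$-linear map with $\frac{\partial x_k}{\partial x_j}=\delta_{jk}$ and $\frac{\partial (ab)}{\partial x_j}=\frac{\partial a}{\partial x_j}b+(-1)^i a\frac{\partial b}{\partial x_j}$ for $a\in\Lambda_{n,i}$. For $\sigma\in\Gamma$, $\mathcal J(\sigma)=\det(\partial\sigma(x_i)/\partial x_j)$ (entries are even, hence central), and the Jacobian group is the subgroup $\Sigma=\{\sigma\in\Gamma\mid\mathcal J(\sigma)=1\}$ of $\Gamma$. *)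

theory Defs
  imports
    "HOL-Library.Cardinality"
    "HOL-Library.Poly_Mapping"
    "HOL-Combinatorics.Permutations"
    "HOL-Algebra.Coset"
begin

text \<open>
  The Grassmann algebra is built literally from its presentation: the free algebra on generators
  indexed by a type 'n, modulo the two-sided ideal generated by the defining relations.  For an
  index type with n elements this is the Grassmann algebra on n generators.

  Words are wrapped in their own datatype, instead of making lists themselves an instance of
  class monoid_add.
\<close>

datatype 'n word = Word (letters: "'n list")

instantiation word :: (type) monoid_add
begin

definition zero_word :: "'a word" where
  "0 = Word []"

definition plus_word :: "'a word \<Rightarrow> 'a word \<Rightarrow> 'a word" where
  "u + v = Word (letters u @ letters v)"

instance
  by standard (simp_all add: zero_word_def plus_word_def)

end

lemma word_plus_eq_0_iff: "0 = u + v \<longleftrightarrow> u = 0 \<and> v = (0 :: 'n word)"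
  by (cases u; cases v) (auto simp: zero_word_def plus_word_def)

type_synonym ('k, 'n) free_algebra = "'n word \<Rightarrow>\<^sub>0 'k"

definition free_gen :: "'n \<Rightarrow> ('k::comm_ring_1, 'n) free_algebra" where
  "free_gen i = Poly_Mapping.single (Word [i]) 1"

inductive_set grassmann_ideal :: "('k::comm_ring_1, 'n) free_algebra set" where
  square: "free_gen i * free_gen i \<in> grassmann_ideal"
| anticommute: "i \<noteq> j \<Longrightarrow>
    free_gen i * free_gen j + free_gen j * free_gen i \<in> grassmann_ideal"
| zero: "0 \<in> grassmann_ideal"
| add: "p \<in> grassmann_ideal \<Longrightarrow> q \<in> grassmann_ideal \<Longrightarrow> p + q \<in> grassmann_ideal"
| mult: "p \<in> grassmann_ideal \<Longrightarrow> a * p * b \<in> grassmann_ideal"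

lemma grassmann_ideal_uminus:
  assumes "p \<in> grassmann_ideal"
  shows "- p \<in> grassmann_ideal"
  using grassmann_ideal.mult[OF assms, of "-1" 1] by simp

lemma grassmann_ideal_mult_left: "p \<in> grassmann_ideal \<Longrightarrow> a * p \<in> grassmann_ideal"
  using grassmann_ideal.mult[of p a 1] by simp

lemma grassmann_ideal_mult_right: "p \<in> grassmann_ideal \<Longrightarrow> p * b \<in> grassmann_ideal"
  using grassmann_ideal.mult[of p 1 b] by simp

lemma lookup_mult_0:
  fixes p q :: "('k::comm_ring_1, 'n) free_algebra"
  shows "Poly_Mapping.lookup (p * q) 0 = Poly_Mapping.lookup p 0 * Poly_Mapping.lookup q 0"
proof -
  have "(\<Sum>v. Poly_Mapping.lookup q v when 0 = u + v) = (Poly_Mapping.lookup q 0 when u = 0)" for u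
  proof -
    have "(\<lambda>v. Poly_Mapping.lookup q v when 0 = u + v) =
        (\<lambda>v. (Poly_Mapping.lookup q v when u = 0) when v = 0)"
      by (auto simp: word_plus_eq_0_iff when_def)
    thus ?thesis
      by (simp only: Sum_any_when_equal)
  qed
  thus ?thesis
    by (simp add: Poly_Mapping.lookup_mult mult_when)
qed

lemma lookup_free_gen_0: "Poly_Mapping.lookup (free_gen i) 0 = 0"
  by (simp add: free_gen_def lookup_single zero_word_def)

lemma grassmann_ideal_lookup_0: "p \<in> grassmann_ideal \<Longrightarrow> Poly_Mapping.lookup p 0 = 0"
  by (induction rule: grassmann_ideal.induct)
    (simp_all add: lookup_mult_0 lookup_add lookup_free_gen_0)

definition grassmann_cong ::
    "('k::comm_ring_1, 'n) free_algebra \<Rightarrow> ('k, 'n) free_algebra \<Rightarrow> bool" where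
  "grassmann_cong p q \<longleftrightarrow> p - q \<in> grassmann_ideal"

lemma equivp_grassmann_cong: "equivp grassmann_cong"
proof (rule equivpI)
  show "reflp grassmann_cong"
    by (auto simp: reflp_def grassmann_cong_def intro: grassmann_ideal.zero)
  show "symp grassmann_cong"
    using grassmann_ideal_uminus by (fastforce simp: symp_def grassmann_cong_def)
  show "transp grassmann_cong"
    using grassmann_ideal.add by (fastforce simp: transp_def grassmann_cong_def)
qed

quotient_type (overloaded) ('k, 'n) grassmann = "('k::comm_ring_1, 'n) free_algebra" / grassmann_cong
  by (rule equivp_grassmann_cong)

instantiation grassmann :: (comm_ring_1, type) ring_1
begin

lift_definition zero_grassmann :: "('a::comm_ring_1, 'b) grassmann" is 0 .

lift_definition one_grassmann :: "('a::comm_ring_1, 'b) grassmann" is 1 .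

lift_definition plus_grassmann ::
    "('a::comm_ring_1, 'b) grassmann \<Rightarrow> ('a, 'b) grassmann \<Rightarrow> ('a, 'b) grassmann" is "(+)"
proof -
  fix p q r s :: "('a, 'b) free_algebra"
  assume "grassmann_cong p q" "grassmann_cong r s"
  hence "(p - q) + (r - s) \<in> grassmann_ideal"
    unfolding grassmann_cong_def by (rule grassmann_ideal.add)
  thus "grassmann_cong (p + r) (q + s)"
    by (simp add: grassmann_cong_def algebra_simps)
qed

lift_definition uminus_grassmann ::
    "('a::comm_ring_1, 'b) grassmann \<Rightarrow> ('a, 'b) grassmann" is uminus
  unfolding grassmann_cong_def by (drule grassmann_ideal_uminus) simp

lift_definition minus_grassmann ::
    "('a::comm_ring_1, 'b) grassmann \<Rightarrow> ('a, 'b) grassmann \<Rightarrow> ('a, 'b) grassmann" is "(-)"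
proof -
  fix p q r s :: "('a, 'b) free_algebra"
  assume "grassmann_cong p q" "grassmann_cong r s"
  hence "(p - q) + - (r - s) \<in> grassmann_ideal"
    unfolding grassmann_cong_def by (intro grassmann_ideal.add grassmann_ideal_uminus)
  thus "grassmann_cong (p - r) (q - s)"
    by (simp add: grassmann_cong_def algebra_simps)
qed

lift_definition times_grassmann ::
    "('a::comm_ring_1, 'b) grassmann \<Rightarrow> ('a, 'b) grassmann \<Rightarrow> ('a, 'b) grassmann" is "(*)"
proof -
  fix p q r s :: "('a, 'b) free_algebra"
  assume "grassmann_cong p q" "grassmann_cong r s"
  hence "(p - q) * r + q * (r - s) \<in> grassmann_ideal"
    unfolding grassmann_cong_def
    by (intro grassmann_ideal.add grassmann_ideal_mult_left grassmann_ideal_mult_right)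
  thus "grassmann_cong (p * r) (q * s)"
    by (simp add: grassmann_cong_def algebra_simps)
qed

instance
proof
  show "(0 :: ('a, 'b) grassmann) \<noteq> 1"
  proof (transfer, rule notI)
    assume "grassmann_cong (0 :: ('a, 'b) free_algebra) 1"
    hence "Poly_Mapping.lookup (0 - 1 :: ('a, 'b) free_algebra) 0 = 0"
      unfolding grassmann_cong_def by (rule grassmann_ideal_lookup_0)
    thus False
      by (simp add: lookup_minus)
  qed
qed (transfer; simp add: algebra_simps grassmann_cong_def grassmann_ideal.zero)+

end

lift_definition gen :: "'n \<Rightarrow> ('k::comm_ring_1, 'n) grassmann" is free_gen .

text \<open>The structure map from K to its Grassmann algebra, and the resulting scalar multiplication.\<close>

lift_definition scalar :: "'k::comm_ring_1 \<Rightarrow> ('k, 'n) grassmann" is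
  "\<lambda>c. Poly_Mapping.single 0 c" .

definition scale :: "'k::comm_ring_1 \<Rightarrow> ('k, 'n) grassmann \<Rightarrow> ('k, 'n) grassmann" where
  "scale c a = scalar c * a"

lemma gen_square: "gen i * gen i = 0"
  by transfer (simp add: grassmann_cong_def grassmann_ideal.square)

lemma gen_anticommute: "i \<noteq> j \<Longrightarrow> gen i * gen j = - (gen j * gen i)"
  by transfer (simp add: grassmann_cong_def grassmann_ideal.anticommute)

definition homogeneous :: "nat \<Rightarrow> ('k::comm_ring_1, 'n) grassmann set" where
  "homogeneous d =
     {\<Sum>w\<in>W. scale (c w) (prod_list (map gen w)) | c W. finite W \<and> (\<forall>w\<in>W. length w = d)}"

text \<open>The sum of the homogeneous components whose degree lies in a given set.\<close>

definition graded_part :: "nat set \<Rightarrow> ('k::comm_ring_1, 'n) grassmann set" where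
  "graded_part D = {\<Sum>d\<in>F. a d | a F. finite F \<and> F \<subseteq> D \<and> (\<forall>d\<in>F. a d \<in> homogeneous d)}"

definition max_ideal :: "('k::comm_ring_1, 'n) grassmann set" where
  "max_ideal = graded_part {1..}"

definition odd_part :: "('k::comm_ring_1, 'n) grassmann set" where
  "odd_part = graded_part {d. odd d}"

definition ideal_times ::
    "('k::comm_ring_1, 'n) grassmann set \<Rightarrow> ('k, 'n) grassmann set \<Rightarrow> ('k, 'n) grassmann set" where
  "ideal_times I J =
     {\<Sum>k<m. f k * g k | f g (m::nat). (\<forall>k<m. f k \<in> I) \<and> (\<forall>k<m. g k \<in> J)}"

definition max_ideal_cubed :: "('k::comm_ring_1, 'n) grassmann set" where
  "max_ideal_cubed = ideal_times (ideal_times max_ideal max_ideal) max_ideal"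

definition K_linear ::
    "(('k::comm_ring_1, 'n) grassmann \<Rightarrow> ('k, 'n) grassmann) \<Rightarrow> bool" where
  "K_linear f \<longleftrightarrow> (\<forall>a b. f (a + b) = f a + f b) \<and> (\<forall>c a. f (scale c a) = scale c (f a))"

definition algebra_automorphism ::
    "(('k::comm_ring_1, 'n) grassmann \<Rightarrow> ('k, 'n) grassmann) \<Rightarrow> bool" where
  "algebra_automorphism f \<longleftrightarrow>
     bij f \<and> K_linear f \<and> f 1 = 1 \<and> (\<forall>a b. f (a * b) = f a * f b)"

definition left_skew_derivation ::
    "'n \<Rightarrow> (('k::comm_ring_1, 'n) grassmann \<Rightarrow> ('k, 'n) grassmann) \<Rightarrow> bool" where
  "left_skew_derivation j D \<longleftrightarrow>
     K_linear D \<and>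
     (\<forall>k. D (gen k) = (if k = j then 1 else 0)) \<and>
     (\<forall>i a b. a \<in> homogeneous i \<longrightarrow> D (a * b) = D a * b + (-1) ^ i * a * D b)"

definition partial :: "'n \<Rightarrow> ('k::comm_ring_1, 'n) grassmann \<Rightarrow> ('k, 'n) grassmann" where
  "partial j = (THE D. left_skew_derivation j D)"

text \<open>
  The library's determinants require a commutative ring, so the determinant is given by the Leibniz
  formula.  The linear order on the index type only fixes the order of the factors, which is
  immaterial for matrices with central entries.
\<close>

definition leibniz_det :: "('n::{finite,linorder} \<Rightarrow> 'n \<Rightarrow> 'a::ring_1) \<Rightarrow> 'a" where
  "leibniz_det M =
     (\<Sum>p | p permutes (UNIV :: 'n set).
        of_int (sign p) * prod_list (map (\<lambda>i. M i (p i)) (sorted_list_of_set UNIV)))"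

definition Jacobian ::
    "(('k::comm_ring_1, 'n::{finite,linorder}) grassmann \<Rightarrow> ('k, 'n) grassmann)
      \<Rightarrow> ('k, 'n) grassmann" where
  "Jacobian \<sigma> = leibniz_det (\<lambda>i j. partial j (\<sigma> (gen i)))"

definition Gamma :: "(('k::comm_ring_1, 'n) grassmann \<Rightarrow> ('k, 'n) grassmann) monoid" where
  "Gamma =
     \<lparr>carrier = {\<sigma>. algebra_automorphism \<sigma> \<and>
                     (\<forall>i. \<sigma> (gen i) - gen i \<in> odd_part \<inter> max_ideal_cubed)},
      mult = (\<circ>),
      one = id\<rparr>"

definition Jacobian_group ::
    "(('k::comm_ring_1, 'n::{finite,linorder}) grassmann \<Rightarrow> ('k, 'n) grassmann) set" where
  "Jacobian_group = {\<sigma> \<in> carrier Gamma. Jacobian \<sigma> = 1}"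

end

theory Submission
  imports "HOL-Analysis.Determinants" Defs
begin

text \<open>
  The chain rule gives \<open>J(\<sigma>\<tau>) = \<sigma>(J(\<tau>)) J(\<sigma>)\<close>, so \<open>\<Sigma>\<close> is always a subgroup of \<open>\<Gamma>\<close>.

  An element of \<open>\<Gamma>\<close> raises the degree filtration by at least 2, up to the identity.  For \<open>n = 4\<close>
  this gives \<open>\<sigma>\<tau>(x\<^sub>i) = \<sigma>(x\<^sub>i) + \<tau>(x\<^sub>i) - x\<^sub>i\<close>, because the error has degree at least 5.  Hence \<open>\<Gamma>\<close>
  is abelian and \<open>\<Sigma>\<close> is normal.

  If \<open>\<Sigma>\<close> is normal, then every \<open>\<sigma> \<in> \<Sigma>\<close> fixes every \<open>J(\<tau>)\<close>: write \<open>\<sigma>\<tau> = \<tau>\<rho>\<close> with \<open>\<rho> \<in> \<Sigma>\<close> and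
  compare Jacobians.  For \<open>n \<ge> 5\<close> take \<open>\<tau>\<close> with \<open>x\<^sub>1 \<mapsto> x\<^sub>1 + x\<^sub>1x\<^sub>2x\<^sub>3\<close>, so that
  \<open>J(\<tau>) = 1 + x\<^sub>2x\<^sub>3\<close>, and \<open>\<sigma> \<in> \<Sigma>\<close> with \<open>x\<^sub>2 \<mapsto> x\<^sub>2 + x\<^sub>1x\<^sub>4x\<^sub>5\<close>.  Then \<open>\<sigma>\<close> moves \<open>J(\<tau>)\<close> by
  \<open>x\<^sub>1x\<^sub>4x\<^sub>5x\<^sub>3 \<noteq> 0\<close>.
\<close>

section \<open>Linear maps on the Grassmann algebra\<close>

text \<open>Words may repeat letters and need not be sorted, so these monomials span the algebra
  without being a basis.\<close>

definition mon :: "'n list \<Rightarrow> ('k::comm_ring_1, 'n) grassmann" where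
  "mon w = prod_list (map gen w)"

lemma mon_Nil [simp]: "mon [] = 1"
  and mon_Cons [simp]: "mon (i # w) = gen i * mon w"
  and mon_append: "mon (u @ v) = mon u * mon v"
  by (simp_all add: mon_def)

lemma single_Nil_eq_1: "Poly_Mapping.single (Word []) 1 = (1 :: ('k::comm_ring_1, 'n) free_algebra)"
  by (simp flip: zero_word_def)

text \<open>An element has finite support, and updating it at a fresh word amounts to adding a
  single term. Zero arises from the coefficient 0.\<close>

lemma free_algebra_induct [case_names single add]:
  fixes p :: "('k::comm_ring_1, 'n) free_algebra"
  assumes single: "\<And>w c. P (Poly_Mapping.single (Word w) c)"
    and add: "\<And>p q. P p \<Longrightarrow> P q \<Longrightarrow> P (p + q)"
  shows "P p"
proof (induction p rule: Poly_Mapping.update_induct)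
  case const
  show ?case
    using single[of _ 0] by simp
next
  case (update p w c)
  have "Poly_Mapping.update w c p = p + Poly_Mapping.single (Word (letters w)) c"
    using update(1)
    by (intro poly_mapping_eqI)
        (auto simp: lookup_update lookup_add lookup_single when_def in_keys_iff)
  then show ?case
    using update(3) single add by metis
qed

section \<open>Scalars and scalar multiplication\<close>

lemma scalar_central: "scalar c * a = a * scalar c"
proof transfer
  fix c :: 'a and p :: "('a, 'b) free_algebra"
  have "Poly_Mapping.single 0 c * p = p * Poly_Mapping.single 0 c"
    by (induction p rule: free_algebra_induct)
      (simp_all add: mult_single algebra_simps)
  then show "grassmann_cong (Poly_Mapping.single 0 c * p) (p * Poly_Mapping.single 0 c)"
    by (simp add: grassmann_cong_def grassmann_ideal.zero)
qed

lemma scalar_add: "scalar (c + d) = scalar c + scalar d"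
  by transfer (simp add: single_add grassmann_cong_def grassmann_ideal.zero)

lemma scalar_mult: "scalar (c * d) = scalar c * scalar d"
  by transfer (simp add: mult_single grassmann_cong_def grassmann_ideal.zero)

lemma scalar_0 [simp]: "scalar 0 = 0"
  by transfer (simp add: grassmann_cong_def grassmann_ideal.zero)

lemma scalar_1 [simp]: "scalar 1 = 1"
  by transfer (simp add: grassmann_cong_def grassmann_ideal.zero)

lemma scale_add_right: "scale c (a + b) = scale c a + scale c b"
  by (simp add: scale_def distrib_left)

lemma scale_diff_right: "scale c (a - b) = scale c a - scale c b"
  by (simp add: scale_def right_diff_distrib)

lemma scale_minus_right: "scale c (- a) = - scale c a"
  by (simp add: scale_def)

lemma scale_sum_right: "scale c (sum f A) = (\<Sum>x\<in>A. scale c (f x))"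
  by (simp add: scale_def sum_distrib_left)

lemma scale_add_left: "scale (c + d) a = scale c a + scale d a"
  by (simp add: scale_def scalar_add distrib_right)

lemma scale_scale: "scale c (scale d a) = scale (c * d) a"
  by (simp add: scale_def scalar_mult mult.assoc)

lemma scale_0_left [simp]: "scale 0 a = 0"
  by (simp add: scale_def)

lemma scale_1 [simp]: "scale 1 a = a"
  by (simp add: scale_def)

lemma scale_0_right [simp]: "scale c 0 = 0"
  by (simp add: scale_def)

lemma scale_mult_left: "scale c a * b = scale c (a * b)"
  by (simp add: scale_def mult.assoc)

lemma scale_mult_right: "a * scale c b = scale c (a * b)"
  unfolding scale_def by (metis mult.assoc scalar_central)

lemma abs_rep_grassmann: "abs_grassmann (rep_grassmann a) = a"
  by (rule Quotient3_abs_rep[OF Quotient3_grassmann])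

lemma abs_grassmann_add: "abs_grassmann (p + q) = abs_grassmann p + abs_grassmann q"
  by (simp add: plus_grassmann.abs_eq)

lemma mon_eq_abs: "mon w = abs_grassmann (Poly_Mapping.single (Word w) 1)"
proof (induction w)
  case Nil
  show ?case
    by (simp add: one_grassmann.abs_eq single_Nil_eq_1)
next
  case (Cons i w)
  then show ?case
    by (simp add: gen.abs_eq times_grassmann.abs_eq free_gen_def mult_single plus_word_def)
qed

lemma scale_mon_eq_abs: "scale c (mon w) = abs_grassmann (Poly_Mapping.single (Word w) c)"
  by (simp add: mon_eq_abs scale_def scalar.abs_eq times_grassmann.abs_eq mult_single)

lemma grassmann_induct [case_names mon add]:
  fixes a :: "('k::comm_ring_1, 'n) grassmann"
  assumes mon: "\<And>w c. P (scale c (mon w))"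
    and add: "\<And>a b. P a \<Longrightarrow> P b \<Longrightarrow> P (a + b)"
  shows "P a"
proof -
  have "P (abs_grassmann p)" for p
    by (induction p rule: free_algebra_induct)
      (simp_all add: mon add abs_grassmann_add flip: scale_mon_eq_abs)
  from this[of "rep_grassmann a"] show ?thesis
    by (simp add: abs_rep_grassmann)
qed

section \<open>Linear maps, determined by their values on monomials\<close>

lemma K_linear_add: "K_linear f \<Longrightarrow> f (a + b) = f a + f b"
  and K_linear_scale: "K_linear f \<Longrightarrow> f (scale c a) = scale c (f a)"
  by (simp_all add: K_linear_def)

lemma K_linear_0: "K_linear f \<Longrightarrow> f 0 = 0"
  by (metis K_linear_scale scale_0_left)

lemma K_linear_minus: "K_linear f \<Longrightarrow> f (- a) = - f a"
  by (metis K_linear_0 K_linear_add add.right_inverse add_eq_0_iff)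

lemma K_linear_diff: "K_linear f \<Longrightarrow> f (a - b) = f a - f b"
  by (metis K_linear_add K_linear_minus diff_conv_add_uminus)

lemma K_linear_sum: "K_linear f \<Longrightarrow> f (sum g A) = (\<Sum>x\<in>A. f (g x))"
  by (induction A rule: infinite_finite_induct) (simp_all add: K_linear_0 K_linear_add)

lemmas K_linear_simps =
  K_linear_add K_linear_scale K_linear_0 K_linear_minus K_linear_diff K_linear_sum

lemma K_linear_ext:
  assumes "K_linear f" "K_linear g" "\<And>w. f (mon w) = g (mon w)"
  shows "f = g"
proof
  fix a
  show "f a = g a"
    by (induction a rule: grassmann_induct) (simp_all add: assms K_linear_add K_linear_scale)
qed

lemma K_linear_compose: "K_linear f \<Longrightarrow> K_linear g \<Longrightarrow> K_linear (\<lambda>a. f (g a))"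
  by (simp add: K_linear_def)

text \<open>
  A function on words descends to a linear map on the Grassmann algebra iff it is alternating.
\<close>

definition alternating :: "('n list \<Rightarrow> ('k::comm_ring_1, 'n) grassmann) \<Rightarrow> bool" where
  "alternating h \<longleftrightarrow>
     (\<forall>u v i. h (u @ i # i # v) = 0) \<and>
     (\<forall>u v i j. h (u @ i # j # v) = - h (u @ j # i # v))"

definition free_extension ::
    "('n list \<Rightarrow> ('k::comm_ring_1, 'n) grassmann) \<Rightarrow> ('k, 'n) free_algebra \<Rightarrow> ('k, 'n) grassmann" where
  "free_extension h p =
     (\<Sum>w\<in>Poly_Mapping.keys p. scale (Poly_Mapping.lookup p w) (h (letters w)))"

text \<open>Enlarging the index set only adds terms with coefficient 0, so two elements can be
  treated over the union of their supports.\<close>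

lemma free_extension_superset:
  assumes "finite A" "Poly_Mapping.keys p \<subseteq> A"
  shows "free_extension h p = (\<Sum>w\<in>A. scale (Poly_Mapping.lookup p w) (h (letters w)))"
  unfolding free_extension_def
  by (rule sum.mono_neutral_left) (use assms in \<open>auto simp: in_keys_iff\<close>)

lemma free_extension_single [simp]:
  "free_extension h (Poly_Mapping.single w c) = scale c (h (letters w))"
  by (subst free_extension_superset[of "{w}"]) simp_all

lemma free_extension_add: "free_extension h (p + q) = free_extension h p + free_extension h q"
proof -
  let ?A = "Poly_Mapping.keys p \<union> Poly_Mapping.keys q"
  show ?thesis
    using keys_add[of p q]
    by (simp add: free_extension_superset[of ?A] lookup_add scale_add_left sum.distrib)
qed

text \<open>The two-sided factors \<open>a\<close> and \<open>b\<close> in the induction absorb the ideal's multiplication rule.\<close>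

lemma free_extension_ideal:
  assumes h: "alternating h" and p: "p \<in> grassmann_ideal"
  shows "free_extension h p = 0"
proof -
  have "free_extension h (a * p * b) = 0" for a b
    using p
  proof (induction arbitrary: a b)
    case (square i)
    show ?case
    proof (induction a rule: free_algebra_induct)
      case (single u c)
      show ?case
        by (induction b rule: free_algebra_induct)
          (use h in \<open>simp_all add: free_gen_def mult_single plus_word_def alternating_def
             free_extension_add distrib_left\<close>)
    qed (simp add: free_extension_add distrib_right)
  next
    case (anticommute i j)
    show ?case
    proof (induction a rule: free_algebra_induct)
      case (single u c)
      show ?case
      proof (induction b rule: free_algebra_induct)
        case (single v d)
        have "h (u @ i # j # v) = - h (u @ j # i # v)"
          using h unfolding alternating_def by blast
        then show ?case
          by (simp add: free_gen_def mult_single plus_word_def free_extension_add algebra_simps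
              scale_minus_right)
      qed (simp add: free_extension_add distrib_left)
    qed (simp add: free_extension_add distrib_right)
  next
    case zero
    show ?case
      by (simp add: free_extension_def)
  next
    case (add p q)
    then show ?case
      by (simp add: free_extension_add distrib_left distrib_right)
  next
    case (mult p c d)
    show ?case
      using mult.IH[of "a * c" "d * b"] by (simp add: mult.assoc)
  qed
  from this[of 1 1] show ?thesis
    by simp
qed

text \<open>The chosen representative makes this total for every \<open>h\<close>. For alternating
  \<open>h\<close> the value does not depend on the choice, by \<open>extend_abs\<close>.\<close>

definition extend ::
    "('n list \<Rightarrow> ('k::comm_ring_1, 'n) grassmann) \<Rightarrow> ('k, 'n) grassmann \<Rightarrow> ('k, 'n) grassmann" where
  "extend h a = free_extension h (rep_grassmann a)"

text \<open>The chosen representative differs from \<open>p\<close> by an element of the ideal,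
  where the free extension of \<open>h\<close> vanishes.\<close>

lemma extend_abs:
  assumes "alternating h"
  shows "extend h (abs_grassmann p) = free_extension h p"
proof -
  have "grassmann_cong (rep_grassmann (abs_grassmann p)) p"
    by (simp add: Quotient3_rep_abs[OF Quotient3_grassmann] equivp_reflp[OF equivp_grassmann_cong])
  then have "free_extension h (rep_grassmann (abs_grassmann p) - p) = 0"
    by (simp add: grassmann_cong_def free_extension_ideal[OF assms])
  then have "free_extension h (rep_grassmann (abs_grassmann p) - p) + free_extension h p = free_extension h p"
    by simp
  then show ?thesis
    unfolding extend_def free_extension_add[symmetric] by simp
qed

lemma extend_scale_mon:
  assumes "alternating h"
  shows "extend h (scale c (mon w)) = scale c (h w)"
  by (simp add: scale_mon_eq_abs extend_abs[OF assms])

lemma extend_mon: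
  assumes "alternating h"
  shows "extend h (mon w) = h w"
  using extend_scale_mon[OF assms, of 1] by simp

lemma K_linear_extend:
  assumes h: "alternating h"
  shows "K_linear (extend h)"
proof -
  have add: "extend h (a + b) = extend h a + extend h b" for a b
    using extend_abs[OF h, of "rep_grassmann a + rep_grassmann b"]
    by (simp add: abs_grassmann_add abs_rep_grassmann free_extension_add extend_def)
  have "extend h (scale c a) = scale c (extend h a)" for c a
    by (induction a rule: grassmann_induct)
      (simp_all add: add scale_add_right scale_scale extend_scale_mon[OF h])
  with add show ?thesis
    by (simp add: K_linear_def)
qed

section \<open>Sign rules for products of generators\<close>

lemma gen_anticommute': "gen i * gen j = - (gen j * gen i)"
  by (cases "i = j") (simp add: gen_square, rule gen_anticommute)

lemma mon_gen_swap:
  "mon w * (gen i :: ('k::comm_ring_1, 'n) grassmann) = (-1) ^ length w * gen i * mon w"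
proof (induction w)
  case (Cons j w)
  have "mon (j # w) * (gen i :: ('k, 'n) grassmann) = gen j * (mon w * gen i)"
    by (simp add: mult.assoc)
  also have "\<dots> = (-1) ^ length w * (gen j * gen i) * mon w"
    unfolding Cons.IH by (cases "even (length w)") (simp_all add: mult.assoc)
  also have "\<dots> = (-1) ^ length (j # w) * gen i * mon (j # w)"
    by (subst gen_anticommute'[of j i]) (simp add: mult.assoc)
  finally show ?case .
qed simp

lemma gen_gen_mult [simp]: "gen i * (gen i * a) = 0"
  by (simp add: gen_square flip: mult.assoc)

lemma gen_swap: "gen i * (gen j * a) = - (gen j * (gen i * a))"
proof -
  have "gen i * gen j * a = - (gen j * gen i) * a"
    by (subst gen_anticommute') (rule refl)
  then show ?thesis
    by (simp add: mult.assoc)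
qed

text \<open>The letters between two equal ones can be passed at the cost of a sign, which brings the
  two together to a square.\<close>

lemma mon_not_distinct:
  assumes "\<not> distinct w"
  shows "(mon w :: ('k::comm_ring_1, 'n) grassmann) = 0"
proof -
  obtain xs ys zs i where w: "w = xs @ [i] @ ys @ [i] @ zs"
    using not_distinct_decomp[OF assms] by blast
  have "(mon w :: ('k, 'n) grassmann) = mon xs * (gen i * (mon ys * gen i)) * mon zs"
    by (simp add: w mon_append mult.assoc)
  also have "gen i * (mon ys * gen i) = (-1) ^ length ys * (gen i * gen i) * (mon ys :: ('k, 'n) grassmann)"
    by (subst mon_gen_swap, cases "even (length ys)") (simp_all add: mult.assoc)
  finally show ?thesis
    by (simp add: gen_square)
qed

section \<open>Graded parts\<close>

text \<open>Projection onto the components with degree in \<open>D\<close>. The defining relations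
  are homogeneous, so keeping or killing a word according to its length respects them.\<close>

definition proj :: "nat set \<Rightarrow> ('k::comm_ring_1, 'n) grassmann \<Rightarrow> ('k, 'n) grassmann" where
  "proj D = extend (\<lambda>w. if length w \<in> D then mon w else 0)"

lemma mon_append_swap: "mon u * (gen i * (gen j * a)) = - (mon u * (gen j * (gen i * a)))"
  by (subst gen_swap) simp

lemma alternating_proj: "alternating (\<lambda>w. if length w \<in> D then mon w else 0)"
  unfolding alternating_def by (auto simp: mon_append intro: mon_append_swap)

lemma K_linear_proj: "K_linear (proj D)"
  unfolding proj_def by (rule K_linear_extend[OF alternating_proj])

lemma proj_mon: "proj D (mon w) = (if length w \<in> D then mon w else 0)"
  unfolding proj_def by (rule extend_mon[OF alternating_proj])

lemma proj_scale_mon: "proj D (scale c (mon w)) = (if length w \<in> D then scale c (mon w) else 0)"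
  by (simp add: K_linear_scale[OF K_linear_proj] proj_mon)

lemma grassmann_eq_sum_mon:
  fixes a :: "('k::comm_ring_1, 'n) grassmann"
  obtains W and c :: "'n list \<Rightarrow> 'k" where "finite W" "a = (\<Sum>w\<in>W. scale (c w) (mon w))"
proof -
  have "\<exists>W (c :: 'n list \<Rightarrow> 'k). finite W \<and> a = (\<Sum>w\<in>W. scale (c w) (mon w))"
  proof (induction a rule: grassmann_induct)
    case (mon w c)
    show ?case
      by (rule exI[of _ "{w}"], rule exI[of _ "\<lambda>_. c"]) simp
  next
    case (add a b)
    then obtain V W and c d :: "'n list \<Rightarrow> 'k"
      where V: "finite V" "a = (\<Sum>w\<in>V. scale (c w) (mon w))"
        and W: "finite W" "b = (\<Sum>w\<in>W. scale (d w) (mon w))"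
      by blast
    \<comment> \<open>Coefficients are extended by 0 so that both sums run over the union of the
      index sets.\<close>
    let ?c = "\<lambda>w. if w \<in> V then c w else 0" and ?d = "\<lambda>w. if w \<in> W then d w else 0"
    have "a = (\<Sum>w\<in>V \<union> W. scale (?c w) (mon w))" "b = (\<Sum>w\<in>V \<union> W. scale (?d w) (mon w))"
      unfolding V(2) W(2) using V(1) W(1) by (intro sum.mono_neutral_cong_left; auto)+
    then have "a + b = (\<Sum>w\<in>V \<union> W. scale (?c w + ?d w) (mon w))"
      by (simp only: scale_add_left sum.distrib)
    then show ?case
      using V(1) W(1) by (intro exI[of _ "V \<union> W"] exI[of _ "\<lambda>w. ?c w + ?d w"] conjI finite_UnI)
  qed
  with that show thesis
    by blast
qed

lemma homogeneous_mon: "scale c (mon w) \<in> homogeneous (length w)"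
  unfolding homogeneous_def mon_def
  by (rule CollectI, rule exI[of _ "\<lambda>_. c"], rule exI[of _ "{w}"]) simp

lemma mon_homogeneous: "mon w \<in> homogeneous (length w)"
  using homogeneous_mon[of 1 w] unfolding scale_1 .

lemma proj_homogeneous:
  assumes "a \<in> homogeneous d"
  shows "proj D a = (if d \<in> D then a else 0)"
proof -
  obtain c W where W: "\<forall>w\<in>W. length w = d" and a: "a = (\<Sum>w\<in>W. scale (c w) (mon w))"
    using assms unfolding homogeneous_def mon_def by blast
  have "proj D a = (\<Sum>w\<in>W. if d \<in> D then scale (c w) (mon w) else 0)"
    unfolding a K_linear_sum[OF K_linear_proj] using W by (intro sum.cong) (simp_all add: proj_scale_mon)
  then show ?thesis
    by (simp add: a)
qed

text \<open>Membership becomes a fixed-point equation of a linear map, so closure properties follow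
  from linearity. Backwards, projecting a sum of monomials discards the words of wrong length; the
  remaining ones are grouped by length.\<close>

lemma graded_part_iff: "a \<in> graded_part D \<longleftrightarrow> proj D a = a"
proof
  assume "a \<in> graded_part D"
  then obtain h F where "F \<subseteq> D" and h: "\<forall>d\<in>F. h d \<in> homogeneous d" and a: "a = sum h F"
    unfolding graded_part_def by blast
  then have "\<forall>d\<in>F. proj D (h d) = h d"
    using proj_homogeneous by (metis subsetD)
  then show "proj D a = a"
    by (simp add: a K_linear_sum[OF K_linear_proj])
next
  assume proj: "proj D a = a"
  obtain W c where W: "finite W" and a: "a = (\<Sum>w\<in>W. scale (c w) (mon w))"
    by (rule grassmann_eq_sum_mon)
  let ?V = "{w \<in> W. length w \<in> D}"
  have "a = (\<Sum>w\<in>W. if length w \<in> D then scale (c w) (mon w) else 0)"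
    by (subst proj[symmetric]) (simp add: a K_linear_sum[OF K_linear_proj] proj_scale_mon)
  also have "\<dots> = (\<Sum>w\<in>?V. scale (c w) (mon w))"
    using W by (simp add: sum.If_cases Int_def)
  also have "\<dots> = (\<Sum>d\<in>length ` ?V. \<Sum>w\<in>{w \<in> ?V. length w = d}. scale (c w) (mon w))"
    using W by (intro sum.image_gen) simp
  finally have "a = (\<Sum>d\<in>length ` ?V. \<Sum>w\<in>{w \<in> ?V. length w = d}. scale (c w) (mon w))" .
  moreover have "(\<Sum>w\<in>{w \<in> ?V. length w = d}. scale (c w) (mon w)) \<in> homogeneous d" for d
    unfolding homogeneous_def mon_def using W
    by (intro CollectI exI[of _ c] exI[of _ "{w \<in> ?V. length w = d}"]) auto
  moreover have "finite (length ` ?V)" "length ` ?V \<subseteq> D"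
    using W by auto
  ultimately show "a \<in> graded_part D"
    unfolding graded_part_def by blast
qed

lemma proj_proj: "proj D (proj E a) = proj (D \<inter> E) a"
  by (induction a rule: grassmann_induct)
    (simp_all add: proj_scale_mon K_linear_0[OF K_linear_proj] K_linear_add[OF K_linear_proj])

lemma proj_in_graded_part: "proj D a \<in> graded_part D"
  by (simp add: graded_part_iff proj_proj)

lemma proj_Compl: "proj D a + proj (- D) a = a"
  by (induction a rule: grassmann_induct)
    (simp_all add: proj_scale_mon K_linear_add[OF K_linear_proj], simp add: algebra_simps)

lemma graded_part_UNIV [simp]: "a \<in> graded_part UNIV"
  unfolding graded_part_iff
  by (induction a rule: grassmann_induct) (simp_all add: proj_scale_mon K_linear_add[OF K_linear_proj])

lemma graded_part_mono: "a \<in> graded_part D \<Longrightarrow> D \<subseteq> E \<Longrightarrow> a \<in> graded_part E"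
  by (metis graded_part_iff inf.absorb_iff2 proj_proj)

lemma graded_part_Int: "a \<in> graded_part D \<Longrightarrow> a \<in> graded_part E \<Longrightarrow> a \<in> graded_part (D \<inter> E)"
  by (metis graded_part_iff proj_proj)

lemma graded_part_scale_mon: "length w \<in> D \<Longrightarrow> scale c (mon w) \<in> graded_part D"
  by (simp add: graded_part_iff proj_scale_mon)

lemma graded_part_mon: "length w \<in> D \<Longrightarrow> mon w \<in> graded_part D"
  by (simp add: graded_part_iff proj_mon)

lemma graded_part_gen: "1 \<in> D \<Longrightarrow> gen i \<in> graded_part D"
  using graded_part_mon[of "[i]" D] by simp

lemma graded_part_1: "0 \<in> D \<Longrightarrow> 1 \<in> graded_part D"
  using graded_part_mon[of "[]" D] by simp

lemma graded_part_0 [simp]: "0 \<in> graded_part D"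
  and graded_part_add: "a \<in> graded_part D \<Longrightarrow> b \<in> graded_part D \<Longrightarrow> a + b \<in> graded_part D"
  and graded_part_minus: "a \<in> graded_part D \<Longrightarrow> - a \<in> graded_part D"
  and graded_part_diff: "a \<in> graded_part D \<Longrightarrow> b \<in> graded_part D \<Longrightarrow> a - b \<in> graded_part D"
  and graded_part_scale: "a \<in> graded_part D \<Longrightarrow> scale c a \<in> graded_part D"
  by (simp_all add: graded_part_iff K_linear_simps[OF K_linear_proj])

lemma graded_part_sum: "(\<And>x. x \<in> A \<Longrightarrow> f x \<in> graded_part D) \<Longrightarrow> sum f A \<in> graded_part D"
  by (simp add: graded_part_iff K_linear_simps[OF K_linear_proj])

text \<open>It suffices to treat projections of arbitrary elements: each monomial is either kept,
  with its length in \<open>D\<close>, or sent to 0.\<close>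

lemma graded_part_induct [consumes 1, case_names mon zero add]:
  fixes a :: "('k::comm_ring_1, 'n) grassmann"
  assumes "a \<in> graded_part D"
    and mon: "\<And>w c. length w \<in> D \<Longrightarrow> P (scale c (mon w))"
    and zero: "P 0"
    and add: "\<And>a b. P a \<Longrightarrow> P b \<Longrightarrow> P (a + b)"
  shows "P a"
proof -
  have "P (proj D b)" for b
    by (induction b rule: grassmann_induct)
      (simp_all add: proj_scale_mon mon zero add K_linear_add[OF K_linear_proj])
  from this[of a] show ?thesis
    using assms(1) by (simp add: graded_part_iff)
qed

lemma graded_part_mult:
  assumes a: "a \<in> graded_part D" and b: "b \<in> graded_part E"
    and "\<And>d e. d \<in> D \<Longrightarrow> e \<in> E \<Longrightarrow> d + e \<in> F"
  shows "a * b \<in> graded_part F"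
  using a
proof (induction a rule: graded_part_induct)
  case (mon v c)
  show ?case
    using b
  proof (induction b rule: graded_part_induct)
    case (mon w d)
    have "scale c (mon v) * scale d (mon w) = scale (d * c) (mon (v @ w))"
      by (simp add: scale_mult_left scale_mult_right scale_scale mon_append)
    with mon \<open>length v \<in> D\<close> assms(3) show ?case
      by (simp add: graded_part_scale_mon)
  qed (simp_all add: distrib_left graded_part_add)
qed (simp_all add: distrib_right graded_part_add)

text \<open>A word longer than the number of letters repeats one of them.\<close>

lemma graded_part_above_card:
  fixes a :: "('k::comm_ring_1, 'n::finite) grassmann"
  assumes "a \<in> graded_part D" and D: "\<And>d. d \<in> D \<Longrightarrow> CARD('n) < d"
  shows "a = 0"
  using assms(1)
proof (induction a rule: graded_part_induct)
  case (mon w c)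
  have "\<not> distinct w"
    using D[OF mon] card_mono[OF finite subset_UNIV, of "set w"] by (auto dest: distinct_card)
  then show ?case
    by (simp add: mon_not_distinct)
qed simp_all

section \<open>Products of ideals and the cube of the maximal ideal\<close>

lemma ideal_times_mult: "a \<in> I \<Longrightarrow> b \<in> J \<Longrightarrow> a * b \<in> ideal_times I J"
  unfolding ideal_times_def
  by (intro CollectI exI[of _ "\<lambda>_. a"] exI[of _ "\<lambda>_. b"] exI[of _ "1"]) simp

lemma ideal_times_0: "0 \<in> ideal_times I J"
  unfolding ideal_times_def by (rule CollectI, intro exI[of _ "\<lambda>_. 0"] exI[of _ "0"]) simp

lemma ideal_times_add_mult:
  assumes "p \<in> ideal_times I J" "a \<in> I" "b \<in> J"
  shows "p + a * b \<in> ideal_times I J"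
proof -
  obtain f g and m :: nat where "\<forall>k<m. f k \<in> I" "\<forall>k<m. g k \<in> J" and p: "p = (\<Sum>k<m. f k * g k)"
    using assms(1) unfolding ideal_times_def by blast
  then have "\<forall>k<Suc m. (f(m := a)) k \<in> I" "\<forall>k<Suc m. (g(m := b)) k \<in> J"
    using assms(2,3) by simp_all
  moreover have "p + a * b = (\<Sum>k<Suc m. (f(m := a)) k * (g(m := b)) k)"
    by (simp add: p)
  ultimately show ?thesis
    unfolding ideal_times_def by blast
qed

lemma ideal_times_add:
  assumes "p \<in> ideal_times I J" "q \<in> ideal_times I J"
  shows "p + q \<in> ideal_times I J"
proof -
  obtain f g and m :: nat where fg: "\<forall>k<m. f k \<in> I" "\<forall>k<m. g k \<in> J" and q: "q = (\<Sum>k<m. f k * g k)"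
    using assms(2) unfolding ideal_times_def by blast
  from fg have "p + (\<Sum>k<m. f k * g k) \<in> ideal_times I J"
  proof (induction m)
    case (Suc m)
    then have "(p + (\<Sum>k<m. f k * g k)) + f m * g m \<in> ideal_times I J"
      by (intro ideal_times_add_mult) simp_all
    then show ?case
      by (simp add: add.assoc)
  qed (simp add: assms(1))
  then show ?thesis
    by (simp add: q)
qed

lemma ideal_times_graded_part:
  assumes "\<And>d e. d \<in> D \<Longrightarrow> e \<in> E \<Longrightarrow> d + e \<in> F"
  shows "ideal_times (graded_part D) (graded_part E) \<subseteq> graded_part F"
  unfolding ideal_times_def using assms by (auto intro!: graded_part_sum graded_part_mult)

lemma ideal_times_mono: "I \<subseteq> I' \<Longrightarrow> ideal_times I J \<subseteq> ideal_times I' J"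
  unfolding ideal_times_def by blast

text \<open>Turns the cube into a degree bound: a word of length at least 3 splits into two
  generators and a nonempty remainder, which carries the scalar.\<close>

lemma max_ideal_cubed_eq: "max_ideal_cubed = graded_part {3..}"
proof
  have "ideal_times (ideal_times max_ideal max_ideal) max_ideal
      \<subseteq> ideal_times (graded_part {2..}) (graded_part {1..})"
    unfolding max_ideal_def by (intro ideal_times_mono ideal_times_graded_part) auto
  also have "\<dots> \<subseteq> graded_part {3..}"
    by (rule ideal_times_graded_part) auto
  finally show "max_ideal_cubed \<subseteq> graded_part {3..}"
    unfolding max_ideal_cubed_def .
next
  show "graded_part {3..} \<subseteq> (max_ideal_cubed :: ('a, 'b) grassmann set)"
  proof
    fix a :: "('a, 'b) grassmann"
    assume "a \<in> graded_part {3..}"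
    then show "a \<in> max_ideal_cubed"
    proof (induction a rule: graded_part_induct)
      case (mon w c)
      then obtain i j k v where w: "w = i # j # k # v"
        by (auto simp: numeral_3_eq_3 Suc_le_length_iff)
      have "scale c (mon (k # v)) \<in> max_ideal"
        unfolding max_ideal_def by (rule graded_part_scale_mon) simp
      then have "gen i * gen j * scale c (mon (k # v)) \<in> max_ideal_cubed"
        unfolding max_ideal_cubed_def
        by (intro ideal_times_mult) (simp_all add: max_ideal_def graded_part_gen)
      moreover have "scale c (mon w) = gen i * gen j * scale c (mon (k # v))"
        by (simp add: w mult.assoc scale_mult_right del: mon_Cons) (simp add: mult.assoc scale_mult_right)
      ultimately show ?case
        by metis
    qed (simp_all add: max_ideal_cubed_def ideal_times_0 ideal_times_add)
  qed
qed

section \<open>Partial derivatives\<close>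

text \<open>The skew Leibniz rule read off on words: the leading letter has degree 1, whence the
  minus sign.\<close>

fun deriv_word :: "'n \<Rightarrow> 'n list \<Rightarrow> ('k::comm_ring_1, 'n) grassmann" where
  "deriv_word j [] = 0"
| "deriv_word j (i # w) = (if i = j then mon w else 0) - gen i * deriv_word j w"

text \<open>At the front of a word the Leibniz terms satisfy the relations directly. A prefix letter
  multiplies the recursive value and possibly adds a monomial, which obeys the same
  relations.\<close>

lemma alternating_deriv_word:
  "alternating (deriv_word j :: 'n list \<Rightarrow> ('k::comm_ring_1, 'n) grassmann)" (is "alternating ?h")
proof -
  have "?h (u @ i # i # v) = 0" for u v i
    by (induction u) (simp_all add: mon_append right_diff_distrib)
  moreover have "?h (u @ i # k # v) = - ?h (u @ k # i # v)" for u v i k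
  proof (induction u)
    case Nil
    show ?case
      by (auto simp: right_diff_distrib intro: gen_swap)
  next
    case (Cons l u)
    then show ?case
      by (auto simp: mon_append intro: mon_append_swap)
  qed
  ultimately show ?thesis
    unfolding alternating_def by blast
qed

text \<open>The rule for one generator and arbitrary \<open>b\<close> is iterated along
  \<open>w\<close>; each letter flips the sign once.\<close>

lemma deriv_mon_mult:
  fixes b :: "('k::comm_ring_1, 'n) grassmann" and j :: 'n
  defines "D \<equiv> extend (deriv_word j)"
  shows "D (mon w * b) = D (mon w) * b + (-1) ^ length w * mon w * D b"
proof -
  have lin: "K_linear D"
    unfolding D_def by (rule K_linear_extend[OF alternating_deriv_word])
  have D_mon: "D (mon v) = deriv_word j v" for v
    unfolding D_def by (rule extend_mon[OF alternating_deriv_word])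
  have D_gen: "D (gen i * b) = (if i = j then b else 0) - gen i * D b" for i b
  proof (induction b rule: grassmann_induct)
    case (mon v c)
    have "D (gen i * mon v) = (if i = j then mon v else 0) - gen i * D (mon v)"
      using D_mon[of "i # v"] D_mon[of v] by simp
    then show ?case
      by (simp add: scale_mult_right K_linear_scale[OF lin] scale_diff_right scale_minus_right)
  qed (simp add: K_linear_add[OF lin] distrib_left)
  show ?thesis
  proof (induction w)
    case Nil
    show ?case
      using D_mon[of "[]"] by simp
  next
    case (Cons i w)
    show ?case
      unfolding mon_Cons mult.assoc D_gen Cons.IH
      by (cases "even (length w)") (simp_all add: algebra_simps)
  qed
qed

lemma left_skew_derivation_extend:
  "left_skew_derivation j (extend (deriv_word j) :: ('k::comm_ring_1, 'n) grassmann \<Rightarrow> _)"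
  (is "left_skew_derivation j ?D")
proof -
  have lin: "K_linear ?D"
    by (rule K_linear_extend[OF alternating_deriv_word])
  have "?D (gen k) = (if k = j then 1 else 0)" for k
  proof -
    have "?D (mon [k]) = deriv_word j [k]"
      by (rule extend_mon[OF alternating_deriv_word])
    then show ?thesis
      by simp
  qed
  moreover have "?D (a * b) = ?D a * b + (-1) ^ i * a * ?D b"
    if "a \<in> homogeneous i" for i a b
  proof -
    \<comment> \<open>Restated as membership in a graded part in order to use induction over
      monomials.\<close>
    have "a \<in> graded_part {i}"
      using that by (simp add: graded_part_iff proj_homogeneous)
    then show ?thesis
    proof (induction a rule: graded_part_induct)
      case (mon w c)
      then show ?case
        by (simp add: scale_mult_left scale_mult_right K_linear_scale[OF lin] deriv_mon_mult scale_add_right)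
    qed (simp_all add: K_linear_0[OF lin] K_linear_add[OF lin] algebra_simps)
  qed
  ultimately show ?thesis
    by (simp add: left_skew_derivation_def lin)
qed

lemma left_skew_derivation_linear: "left_skew_derivation j D \<Longrightarrow> K_linear D"
  and left_skew_derivation_gen: "left_skew_derivation j D \<Longrightarrow> D (gen k) = (if k = j then 1 else 0)"
  and left_skew_derivation_mult:
  "left_skew_derivation j D \<Longrightarrow> a \<in> homogeneous i \<Longrightarrow> D (a * b) = D a * b + (-1) ^ i * a * D b"
  by (simp_all add: left_skew_derivation_def)

lemma left_skew_derivation_mon_mult:
  "left_skew_derivation j D \<Longrightarrow> D (mon w * b) = D (mon w) * b + (-1) ^ length w * mon w * D b"
  by (erule left_skew_derivation_mult) (rule mon_homogeneous)

text \<open>The Leibniz rule for a leading generator is exactly the recursion of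
  \<open>deriv_word\<close>, so the values on monomials are forced.\<close>

lemma left_skew_derivation_unique:
  assumes "left_skew_derivation j D"
  shows "D = extend (deriv_word j)"
proof -
  note lin = left_skew_derivation_linear[OF assms]
    and gen = left_skew_derivation_gen[OF assms]
    and mult = left_skew_derivation_mon_mult[OF assms]
  \<comment> \<open>The rule for the product of 1 with itself reads
    \<open>D 1 = D 1 + D 1\<close>.\<close>
  have "D 1 = 0"
    using mult[of "[]" 1] by simp
  have "D (mon w) = deriv_word j w" for w
  proof (induction w)
    case (Cons i w)
    have "D (gen i * mon w) = D (gen i) * mon w - gen i * D (mon w)"
      using mult[of "[i]"] by simp
    with Cons show ?case
      by (simp add: gen)
  qed (simp add: \<open>D 1 = 0\<close>)
  then show ?thesis
    by (intro K_linear_ext lin K_linear_extend alternating_deriv_word)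
      (simp add: extend_mon[OF alternating_deriv_word])
qed

text \<open>Existence and uniqueness give the definite description in \<open>partial\<close> its
  meaning.\<close>

lemma left_skew_derivation_partial: "left_skew_derivation j (partial j)"
  unfolding partial_def
  by (rule theI[of "left_skew_derivation j", OF left_skew_derivation_extend left_skew_derivation_unique])

lemma K_linear_partial: "K_linear (partial j)"
  and partial_gen: "partial j (gen k) = (if k = j then 1 else 0)"
  by (rule left_skew_derivation_linear left_skew_derivation_gen, rule left_skew_derivation_partial)+

lemma partial_mon_mult:
  "partial j (mon w * b) = partial j (mon w) * b + (-1) ^ length w * mon w * partial j b"
  by (rule left_skew_derivation_mon_mult[OF left_skew_derivation_partial])

lemma partial_1 [simp]: "partial j 1 = 0"
  using partial_mon_mult[of j "[]" 1] by simp

lemma partial_gen_mult: "partial j (gen i * b) = (if i = j then b else 0) - gen i * partial j b"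
  using partial_mon_mult[of j "[i]" b] by (simp add: partial_gen)

lemma partial_odd_mult:
  assumes "a \<in> graded_part {d. odd d}"
  shows "partial j (a * b) = partial j a * b - a * partial j b"
  using assms
proof (induction a rule: graded_part_induct)
  case (mon w c)
  then show ?case
    by (simp add: scale_mult_left scale_mult_right K_linear_simps[OF K_linear_partial] partial_mon_mult
        scale_diff_right)
qed (simp_all add: K_linear_simps[OF K_linear_partial] algebra_simps)

lemma partial_graded_part:
  fixes a :: "('k::comm_ring_1, 'n) grassmann"
  assumes "a \<in> graded_part D" and DE: "\<And>d. Suc d \<in> D \<Longrightarrow> d \<in> E"
  shows "partial j a \<in> graded_part E"
  using assms(1)
proof (induction a rule: graded_part_induct)
  case (mon w c)
  \<comment> \<open>For the empty word this set of degrees is empty, in accordance with the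
    derivative of 1 being 0.\<close>
  have "partial j (mon w :: ('k, 'n) grassmann) \<in> graded_part {d. Suc d = length w}"
  proof (induction w)
    case (Cons i w)
    have "gen i * partial j (mon w :: ('k, 'n) grassmann) \<in> graded_part {d. d = length w}"
      by (rule graded_part_mult[OF graded_part_gen[of "{1}"] Cons.IH]) auto
    then show ?case
      by (auto simp: partial_gen_mult intro!: graded_part_diff graded_part_minus graded_part_mon)
  qed simp
  then have "partial j (mon w :: ('k, 'n) grassmann) \<in> graded_part E"
    by (rule graded_part_mono) (use mon DE in auto)
  then show ?case
    by (simp add: K_linear_simps[OF K_linear_partial] graded_part_scale)
qed (simp_all add: K_linear_simps[OF K_linear_partial] graded_part_add)

section \<open>Even and odd elements\<close>

abbreviation even_elements :: "('k::comm_ring_1, 'n) grassmann set" where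
  "even_elements \<equiv> graded_part {d. even d}"

abbreviation odd_elements :: "('k::comm_ring_1, 'n) grassmann set" where
  "odd_elements \<equiv> graded_part {d. odd d}"

text \<open>One sign for each pair of letters taken from the two words.\<close>

lemma mon_mon_swap:
  "mon v * (mon w :: ('k::comm_ring_1, 'n) grassmann) = (-1) ^ (length v * length w) * (mon w * mon v)"
proof (induction w)
  case (Cons i w)
  have "mon v * (mon (i # w) :: ('k, 'n) grassmann) = (-1) ^ length v * gen i * (mon v * mon w)"
    by (simp add: mon_gen_swap flip: mult.assoc)
  also have "\<dots> = (-1) ^ (length v * length (i # w)) * (mon (i # w) * mon v)"
    unfolding Cons.IH
    by (cases "even (length v)"; cases "even (length w)") (simp_all add: mult.assoc)
  finally show ?case .
qed simp

lemma even_central: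
  assumes "a \<in> even_elements"
  shows "a * b = b * a"
  using assms
proof (induction a rule: graded_part_induct)
  case (mon v c)
  show ?case
  proof (induction b rule: grassmann_induct)
    case (mon w d)
    show ?case
      using \<open>length v \<in> _\<close>
      by (simp add: mon_mon_swap[of v w] scale_mult_left scale_mult_right scale_scale mult.commute)
  qed (simp add: distrib_left distrib_right)
qed (simp_all add: distrib_left distrib_right)

lemma odd_anticommute:
  assumes "a \<in> odd_elements" "b \<in> odd_elements"
  shows "a * b = - (b * a)"
  using assms(1)
proof (induction a rule: graded_part_induct)
  case (mon v c)
  show ?case
    using assms(2)
  proof (induction b rule: graded_part_induct)
    case (mon w d)
    show ?case
      using \<open>length v \<in> _\<close> mon
      by (simp add: mon_mon_swap[of v w] scale_mult_left scale_mult_right scale_scale scale_minus_right mult.commute)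
  qed (simp_all add: distrib_left distrib_right)
qed (simp_all add: distrib_left distrib_right)

text \<open>Anticommutation alone gives only \<open>a * a + a * a = 0\<close>, and 2 may be a zero
  divisor in \<open>K\<close>. Hence the induction: monomials of odd length have square 0, and the
  cross terms cancel.\<close>

lemma odd_square:
  assumes "a \<in> odd_elements"
  shows "a * a = 0"
proof -
  \<comment> \<open>Oddness is carried along because the cross terms cancel by anticommutation of
    odd elements.\<close>
  have "a \<in> odd_elements \<and> a * a = 0"
    using assms
  proof (induction a rule: graded_part_induct)
    case (mon w c)
    then obtain i v where "w = i # v"
      by (cases w) auto
    then have "mon w * (mon w :: ('a, 'b) grassmann) = mon ([] @ i # v @ i # v)"
      by (simp add: mon_append mult.assoc)
    also have "\<dots> = 0"
      by (rule mon_not_distinct) simp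
    finally show ?case
      using mon by (simp add: scale_mult_left scale_mult_right graded_part_scale_mon)
  next
    case (add a b)
    then have "(a + b) * (a + b) = a * b + b * a"
      by (simp add: distrib_left distrib_right)
    with add odd_anticommute[of a b] show ?case
      by (simp add: graded_part_add)
  qed simp
  then show ?thesis
    by simp
qed

lemma gen_odd: "gen i \<in> odd_elements"
  by (simp add: graded_part_gen)

section \<open>Algebra endomorphisms\<close>

definition algebra_hom :: "(('k::comm_ring_1, 'n) grassmann \<Rightarrow> ('k, 'n) grassmann) \<Rightarrow> bool" where
  "algebra_hom f \<longleftrightarrow> K_linear f \<and> f 1 = 1 \<and> (\<forall>a b. f (a * b) = f a * f b)"

lemma algebra_automorphism_iff: "algebra_automorphism f \<longleftrightarrow> bij f \<and> algebra_hom f"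
  by (auto simp: algebra_automorphism_def algebra_hom_def)

lemma algebra_hom_linear: "algebra_hom f \<Longrightarrow> K_linear f"
  and algebra_hom_1: "algebra_hom f \<Longrightarrow> f 1 = 1"
  and algebra_hom_mult: "algebra_hom f \<Longrightarrow> f (a * b) = f a * f b"
  by (simp_all add: algebra_hom_def)

lemmas algebra_hom_simps = algebra_hom_1 algebra_hom_mult K_linear_simps[OF algebra_hom_linear]

lemma algebra_hom_compose: "algebra_hom f \<Longrightarrow> algebra_hom g \<Longrightarrow> algebra_hom (f \<circ> g)"
  by (simp add: algebra_hom_def K_linear_def)

lemma algebra_hom_id: "algebra_hom id"
  by (simp add: algebra_hom_def K_linear_def)

lemma algebra_hom_ext:
  assumes f: "algebra_hom f" and g: "algebra_hom g" and gen: "\<And>i. f (gen i) = g (gen i)"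
  shows "f = g"
proof (rule K_linear_ext)
  show "f (mon w) = g (mon w)" for w
    by (induction w) (simp_all add: algebra_hom_simps[OF f] algebra_hom_simps[OF g] gen)
qed (use f g in \<open>simp_all add: algebra_hom_linear\<close>)

lemma algebra_hom_inv:
  assumes f: "algebra_hom f" and "bij f"
  shows "algebra_hom (inv_into UNIV f)"
proof -
  have inv_eq: "inv_into UNIV f b = a" if "f a = b" for a b
    using that bij_is_inj[OF \<open>bij f\<close>] by (auto simp: inv_f_f)
  have f_inv: "f (inv_into UNIV f a) = a" for a
    using bij_is_surj[OF \<open>bij f\<close>] by (simp add: surj_f_inv_f)
  show ?thesis
    unfolding algebra_hom_def K_linear_def
    by (auto intro!: inv_eq simp: f_inv algebra_hom_simps[OF f])
qed

definition endomorphism ::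
    "('n \<Rightarrow> ('k::comm_ring_1, 'n) grassmann) \<Rightarrow> ('k, 'n) grassmann \<Rightarrow> ('k, 'n) grassmann" where
  "endomorphism \<phi> = extend (\<lambda>w. prod_list (map \<phi> w))"

text \<open>Odd elements anticommute and square to 0, so sending a word to the product of the images
  respects the relations. Thus arbitrary odd images of the generators define an
  endomorphism.\<close>

lemma endomorphism_hom:
  assumes odd: "\<And>i. \<phi> i \<in> odd_elements"
  shows "algebra_hom (endomorphism \<phi>)" "endomorphism \<phi> (gen i) = \<phi> i"
proof -
  let ?h = "\<lambda>w. prod_list (map \<phi> w)"
  have [simp]: "\<phi> i * (\<phi> i * a) = 0" for i a
    using odd_square[OF odd] by (simp flip: mult.assoc)
  have swap: "a * (\<phi> i * (\<phi> j * b)) = - (a * (\<phi> j * (\<phi> i * b)))" for i j a b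
  proof -
    have "a * (\<phi> i * \<phi> j) * b = a * (- (\<phi> j * \<phi> i)) * b"
      by (subst odd_anticommute[OF odd odd]) (rule refl)
    then show ?thesis
      by (simp add: mult.assoc)
  qed
  have alt: "alternating ?h"
    by (auto simp: alternating_def intro: swap)
  note lin = K_linear_extend[OF alt, folded endomorphism_def]
    and mon = extend_mon[OF alt, folded endomorphism_def]
  show "endomorphism \<phi> (gen i) = \<phi> i"
    using mon[of "[i]"] by simp
  have mult: "endomorphism \<phi> (a * b) = endomorphism \<phi> a * endomorphism \<phi> b" for a b
  proof (induction a rule: grassmann_induct)
    case m: (mon v c)
    show ?case
    proof (induction b rule: grassmann_induct)
      case (mon w d)
      show ?case
        by (simp add: scale_mult_left scale_mult_right K_linear_simps[OF lin] mon flip: mon_append)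
          (simp add: \<open>\<And>w. endomorphism \<phi> (mon w) = _\<close>)
    qed (simp add: distrib_left K_linear_simps[OF lin])
  qed (simp add: distrib_right K_linear_simps[OF lin])
  have "endomorphism \<phi> 1 = 1"
    using mon[of "[]"] by simp
  with mult lin show "algebra_hom (endomorphism \<phi>)"
    by (simp add: algebra_hom_def)
qed

text \<open>The Boolean \<open>e\<close> selects the parity, so that one induction covers both
  cases.\<close>

lemma algebra_hom_parity:
  assumes f: "algebra_hom f" and gen: "\<And>i. f (gen i) \<in> odd_elements"
    and a: "a \<in> graded_part {d. even d = e}"
  shows "f a \<in> graded_part {d. even d = e}"
  using a
proof (induction a rule: graded_part_induct)
  case (mon w c)
  have "f (mon w) \<in> graded_part {d. even d = even (length w)}"
  proof (induction w)
    case (Cons i w)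
    show ?case
      unfolding mon_Cons algebra_hom_mult[OF f]
      by (rule graded_part_mult[OF gen Cons.IH]) auto
  qed (simp add: algebra_hom_1[OF f] graded_part_1)
  with mon show ?case
    by (simp add: algebra_hom_simps[OF f] graded_part_scale)
qed (simp_all add: algebra_hom_simps[OF f] graded_part_add)

lemma algebra_hom_even:
  assumes "algebra_hom f" "\<And>i. f (gen i) \<in> odd_elements" "a \<in> even_elements"
  shows "f a \<in> even_elements"
  using algebra_hom_parity[of f a True] assms by simp

lemma algebra_hom_odd:
  assumes "algebra_hom f" "\<And>i. f (gen i) \<in> odd_elements" "a \<in> odd_elements"
  shows "f a \<in> odd_elements"
  using algebra_hom_parity[of f a False] assms by simp

section \<open>The chain rule\<close>

lemma partial_even: "a \<in> odd_elements \<Longrightarrow> partial j a \<in> even_elements"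
  by (erule partial_graded_part) simp

text \<open>Both sides are linear in \<open>a\<close>, so they are compared on monomials, letter by
  letter.\<close>

lemma partial_chain_rule:
  fixes f :: "('k::comm_ring_1, 'n::finite) grassmann \<Rightarrow> ('k, 'n) grassmann"
  assumes f: "algebra_hom f" and gen: "\<And>i. f (gen i) \<in> odd_elements"
  shows "partial j (f a) = (\<Sum>k\<in>UNIV. f (partial k a) * partial j (f (gen k)))"
proof -
  let ?L = "\<lambda>a. partial j (f a)" and ?R = "\<lambda>a. \<Sum>k\<in>UNIV. f (partial k a) * partial j (f (gen k))"
  note simps = algebra_hom_simps[OF f] K_linear_simps[OF K_linear_partial]
  have "?L = ?R"
  proof (rule K_linear_ext)
    show "K_linear ?L"
      by (intro K_linear_compose[OF K_linear_partial] algebra_hom_linear f)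
    show "K_linear ?R"
      by (simp add: K_linear_def simps distrib_right sum.distrib scale_mult_left scale_sum_right)
    show "?L (mon w) = ?R (mon w)" for w
    proof (induction w)
      case (Cons i w)
      \<comment> \<open>Even elements are central; this lets the derivative move past
        \<open>f (mon w)\<close>.\<close>
      have even: "partial j (f (gen k)) \<in> even_elements" for k
        by (rule partial_even[OF gen])
      have "?L (mon (i # w)) = partial j (f (gen i)) * f (mon w) - f (gen i) * ?L (mon w)"
        by (simp add: simps partial_odd_mult[OF gen])
      also have "\<dots> = f (mon w) * partial j (f (gen i)) - f (gen i) * ?R (mon w)"
        unfolding Cons.IH even_central[OF even] ..
      \<comment> \<open>The single term is written as a Kronecker sum over \<open>k\<close> so that
        it merges with the sum from the induction hypothesis.\<close>
      also have "f (mon w) * partial j (f (gen i)) =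
          (\<Sum>k\<in>UNIV. if i = k then f (mon w) * partial j (f (gen k)) else 0)"
        by simp
      also have "\<dots> - f (gen i) * ?R (mon w) = ?R (mon (i # w))"
        unfolding sum_distrib_left sum_subtractf[symmetric]
        by (intro sum.cong) (simp_all add: partial_gen_mult simps left_diff_distrib mult.assoc)
      finally show ?case .
    qed (simp add: simps)
  qed
  then show ?thesis
    by (rule fun_cong)
qed

text \<open>
  Even elements commute, so as a type of their own they form a commutative ring to which the
  library's determinants and their multiplicativity apply.
\<close>

typedef (overloaded) ('k, 'n) even_grassmann = "even_elements :: ('k::comm_ring_1, 'n) grassmann set"
  morphisms of_even to_even
  by (rule exI[of _ 0]) simp

setup_lifting type_definition_even_grassmann

instantiation even_grassmann :: (comm_ring_1, type) comm_ring_1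
begin

lift_definition zero_even_grassmann :: "('a, 'b) even_grassmann" is 0
  by simp

lift_definition one_even_grassmann :: "('a, 'b) even_grassmann" is 1
  by (simp add: graded_part_1)

lift_definition plus_even_grassmann ::
    "('a, 'b) even_grassmann \<Rightarrow> ('a, 'b) even_grassmann \<Rightarrow> ('a, 'b) even_grassmann" is "(+)"
  by (rule graded_part_add)

lift_definition uminus_even_grassmann :: "('a, 'b) even_grassmann \<Rightarrow> ('a, 'b) even_grassmann" is uminus
  by (rule graded_part_minus)

lift_definition minus_even_grassmann ::
    "('a, 'b) even_grassmann \<Rightarrow> ('a, 'b) even_grassmann \<Rightarrow> ('a, 'b) even_grassmann" is "(-)"
  by (rule graded_part_diff)

lift_definition times_even_grassmann ::
    "('a, 'b) even_grassmann \<Rightarrow> ('a, 'b) even_grassmann \<Rightarrow> ('a, 'b) even_grassmann" is "(*)"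
  by (erule graded_part_mult) auto

instance
  by standard (transfer; simp add: algebra_simps even_central; fail)+

end

section \<open>Determinants with even entries and the Jacobian of a composition\<close>

lemma of_even_sum: "of_even (sum f A) = (\<Sum>x\<in>A. of_even (f x))"
  by (induction A rule: infinite_finite_induct)
    (simp_all add: zero_even_grassmann.rep_eq plus_even_grassmann.rep_eq)

lemma of_even_prod_list: "of_even (prod_list xs) = prod_list (map of_even xs)"
  by (induction xs) (simp_all add: one_even_grassmann.rep_eq times_even_grassmann.rep_eq)

lemma of_even_of_nat: "of_even (of_nat n) = of_nat n"
  by (induction n)
    (simp_all add: zero_even_grassmann.rep_eq one_even_grassmann.rep_eq plus_even_grassmann.rep_eq)

lemma of_even_of_int: "of_even (of_int n) = of_int n"
  by (cases n rule: int_diff_cases) (simp add: minus_even_grassmann.rep_eq of_even_of_nat)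

text \<open>In the commutative ring of even elements, the product along the sorted list of rows is
  the unordered product of the usual determinant.\<close>

lemma leibniz_det_eq_det:
  fixes M :: "'m::{finite,linorder} \<Rightarrow> 'm \<Rightarrow> ('k::comm_ring_1, 'n) grassmann"
  assumes "\<And>i j. M i j \<in> even_elements"
  shows "leibniz_det M = of_even (det (\<chi> i j. to_even (M i j)))"
proof -
  have "prod g UNIV = prod_list (map g (sorted_list_of_set UNIV))"
    for g :: "'m \<Rightarrow> ('k, 'n) even_grassmann"
    using prod.distinct_set_conv_list[of "sorted_list_of_set (UNIV :: 'm set)" g] by simp
  then show ?thesis
    by (simp add: leibniz_det_def det_def of_even_sum times_even_grassmann.rep_eq of_even_of_int
        of_even_prod_list o_def to_even_inverse[OF assms])
qed

lemma leibniz_det_mult: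
  fixes A B :: "'m::{finite,linorder} \<Rightarrow> 'm \<Rightarrow> ('k::comm_ring_1, 'n) grassmann"
  assumes A: "\<And>i j. A i j \<in> even_elements" and B: "\<And>i j. B i j \<in> even_elements"
  shows "leibniz_det (\<lambda>i j. \<Sum>k\<in>UNIV. A i k * B k j) = leibniz_det A * leibniz_det B"
proof -
  let ?A = "\<chi> i j. to_even (A i j)" and ?B = "\<chi> i j. to_even (B i j)"
  have AB: "(\<Sum>k\<in>UNIV. A i k * B k j) \<in> even_elements" for i j
    by (intro graded_part_sum graded_part_mult[OF A B]) auto
  have "to_even (\<Sum>k\<in>UNIV. A i k * B k j) = (\<Sum>k\<in>UNIV. to_even (A i k) * to_even (B k j))" for i j
    by (simp add: of_even_sum times_even_grassmann.rep_eq to_even_inverse A B AB flip: of_even_inject)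
  then have "(\<chi> i j. to_even (\<Sum>k\<in>UNIV. A i k * B k j)) = ?A ** ?B"
    by (simp add: matrix_matrix_mult_def)
  then show ?thesis
    by (simp add: leibniz_det_eq_det[OF A] leibniz_det_eq_det[OF B] leibniz_det_eq_det[OF AB] det_mul
        times_even_grassmann.rep_eq)
qed

lemma algebra_hom_leibniz_det:
  assumes f: "algebra_hom f"
  shows "f (leibniz_det M) = leibniz_det (\<lambda>i j. f (M i j))"
proof -
  note simps = algebra_hom_simps[OF f]
  have nat: "f (of_nat n) = of_nat n" for n
    by (induction n) (simp_all add: simps)
  have "f (of_int n) = of_int n" for n
    by (cases n rule: int_diff_cases) (simp add: simps nat)
  moreover have "f (prod_list xs) = prod_list (map f xs)" for xs
    by (induction xs) (simp_all add: simps)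
  ultimately show ?thesis
    by (simp add: leibniz_det_def simps o_def)
qed

text \<open>By the chain rule the matrix of \<open>f \<circ> g\<close> is the image under
  \<open>f\<close> of the matrix of \<open>g\<close>, times the matrix of \<open>f\<close>. All
  entries are even, so the determinant is multiplicative.\<close>

lemma Jacobian_compose:
  assumes f: "algebra_hom f" "\<And>i. f (gen i) \<in> odd_elements"
    and g: "\<And>i. g (gen i) \<in> odd_elements"
  shows "Jacobian (f \<circ> g) = f (Jacobian g) * Jacobian f"
proof -
  have "Jacobian (f \<circ> g) =
      leibniz_det (\<lambda>i j. \<Sum>k\<in>UNIV. f (partial k (g (gen i))) * partial j (f (gen k)))"
    unfolding Jacobian_def comp_def
    by (intro arg_cong[of _ _ leibniz_det] ext partial_chain_rule f)
  also have "\<dots> = leibniz_det (\<lambda>i j. f (partial j (g (gen i)))) * Jacobian f"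
    unfolding Jacobian_def
    by (intro leibniz_det_mult algebra_hom_even[OF f] partial_even f g)
  finally show ?thesis
    by (simp add: Jacobian_def algebra_hom_leibniz_det[OF f(1)])
qed

text \<open>Serves for maps that move a single generator. Every permutation other than the identity
  moves some row different from \<open>k\<close> and so picks up a factor 0.\<close>

lemma leibniz_det_single_row:
  fixes M :: "'n::{finite,linorder} \<Rightarrow> 'n \<Rightarrow> 'a::ring_1"
  assumes "\<And>i j. i \<noteq> k \<Longrightarrow> M i j = (if i = j then 1 else 0)"
  shows "leibniz_det M = M k k"
proof -
  let ?term = "\<lambda>p. of_int (sign p) * prod_list (map (\<lambda>i. M i (p i)) (sorted_list_of_set UNIV))"
  have "?term p = 0" if "p permutes UNIV" "p \<noteq> id" for p
  proof -
    have "\<exists>i. i \<noteq> k \<and> p i \<noteq> i"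
    proof (rule ccontr)
      assume "\<nexists>i. i \<noteq> k \<and> p i \<noteq> i"
      then have *: "p i = i" if "i \<noteq> k" for i
        using that by blast
      then have "p k = k"
        using permutes_inj[OF that(1)] by (metis injD)
      with * that(2) show False
        by (metis ext id_apply)
    qed
    then obtain i where "i \<noteq> k" "p i \<noteq> i"
      by blast
    then have "M i (p i) = 0"
      using assms[of i "p i"] by simp
    then have "0 \<in> set (map (\<lambda>i. M i (p i)) (sorted_list_of_set UNIV))"
      by force
    then have "prod_list (map (\<lambda>i. M i (p i)) (sorted_list_of_set UNIV)) = 0"
      by (metis mult_zero_left mult_zero_right prod_list.Cons prod_list.append split_list)
    then show ?thesis
      by simp
  qed
  then have "leibniz_det M = (\<Sum>p\<in>{id}. ?term p)"
    unfolding leibniz_det_def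
    by (intro sum.mono_neutral_right) (auto simp: permutes_id finite_permutations)
  also have "\<dots> = prod_list (map (\<lambda>i. M i i) (sorted_list_of_set UNIV))"
    by (simp add: sign_id)
  also have "\<dots> = M k k"
  proof -
    have one: "prod_list (map (\<lambda>i. M i i) xs) = 1" if "k \<notin> set xs" for xs
      using that assms by (induction xs) auto
    obtain us vs where "sorted_list_of_set (UNIV :: 'n set) = us @ k # vs"
      by (metis UNIV_I finite set_sorted_list_of_set split_list)
    moreover from this have "k \<notin> set us" "k \<notin> set vs"
      using distinct_sorted_list_of_set[of "UNIV :: 'n set"] by auto
    ultimately show ?thesis
      by (simp add: one)
  qed
  finally show ?thesis .
qed

section \<open>The group of unipotent automorphisms\<close>

lemma Gamma_mult [simp]: "\<sigma> \<otimes>\<^bsub>Gamma\<^esub> \<tau> = \<sigma> \<circ> \<tau>"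
  and Gamma_one [simp]: "\<one>\<^bsub>Gamma\<^esub> = id"
  by (simp_all add: Gamma_def)

lemma Gamma_iff:
  "\<sigma> \<in> carrier Gamma \<longleftrightarrow> bij \<sigma> \<and> algebra_hom \<sigma> \<and>
     (\<forall>i. \<sigma> (gen i) - gen i \<in> odd_elements \<and> \<sigma> (gen i) - gen i \<in> graded_part {3..})"
  by (simp add: Gamma_def algebra_automorphism_iff odd_part_def max_ideal_cubed_eq)

lemma Gamma_hom: "\<sigma> \<in> carrier Gamma \<Longrightarrow> algebra_hom \<sigma>"
  and Gamma_bij: "\<sigma> \<in> carrier Gamma \<Longrightarrow> bij \<sigma>"
  and Gamma_diff_odd: "\<sigma> \<in> carrier Gamma \<Longrightarrow> \<sigma> (gen i) - gen i \<in> odd_elements"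
  and Gamma_diff_cubed: "\<sigma> \<in> carrier Gamma \<Longrightarrow> \<sigma> (gen i) - gen i \<in> graded_part {3..}"
  by (simp_all add: Gamma_iff)

lemma Gamma_gen_odd: "\<sigma> \<in> carrier Gamma \<Longrightarrow> \<sigma> (gen i) \<in> odd_elements"
  using graded_part_add[OF Gamma_diff_odd[of \<sigma> i] gen_odd[of i]] by simp

text \<open>Peeling off one letter leaves two error terms: the image of a generator, of degree at
  least 1, times the inductive error, and an error of degree at least 3 times the remaining
  word.\<close>

lemma Gamma_diff:
  fixes a :: "('k::comm_ring_1, 'n) grassmann"
  assumes \<sigma>: "\<sigma> \<in> carrier Gamma" and a: "a \<in> graded_part {k..}"
  shows "\<sigma> a - a \<in> graded_part {k + 2..}"
  using a
proof (induction a rule: graded_part_induct)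
  case (mon w c)
  note simps = algebra_hom_simps[OF Gamma_hom[OF \<sigma>]]
  have gen: "\<sigma> (gen i) \<in> graded_part {1..}" for i
    using graded_part_add[OF graded_part_mono[OF Gamma_diff_cubed[OF \<sigma>]] graded_part_gen, of "{1..}" i i]
    by simp
  have "\<sigma> (mon w) - mon w \<in> graded_part {length w + 2..}"
  proof (induction w)
    case (Cons i w)
    have "\<sigma> (mon (i # w)) - mon (i # w) =
        \<sigma> (gen i) * (\<sigma> (mon w) - mon w) + (\<sigma> (gen i) - gen i) * mon w"
      by (simp add: simps algebra_simps)
    moreover have "\<sigma> (gen i) * (\<sigma> (mon w) - mon w) \<in> graded_part {length (i # w) + 2..}"
      by (rule graded_part_mult[OF gen Cons.IH]) auto
    moreover have "(\<sigma> (gen i) - gen i) * mon w \<in> graded_part {length (i # w) + 2..}"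
      by (rule graded_part_mult[OF Gamma_diff_cubed[OF \<sigma>] graded_part_mon[of w "{length w}"]]) auto
    ultimately show ?case
      by (simp only: graded_part_add)
  qed (simp add: simps)
  then have "\<sigma> (mon w) - mon w \<in> graded_part {k + 2..}"
    by (rule graded_part_mono) (use mon in auto)
  then show ?case
    by (simp add: simps graded_part_scale flip: scale_diff_right)
next
  case (add a b)
  then show ?case
    using graded_part_add[of "\<sigma> a - a" _ "\<sigma> b - b"]
    by (simp add: algebra_hom_simps[OF Gamma_hom[OF \<sigma>]] algebra_simps)
qed (simp add: algebra_hom_simps[OF Gamma_hom[OF \<sigma>]])

lemma Gamma_filtration:
  assumes "\<sigma> \<in> carrier Gamma" "a \<in> graded_part {k..}"
  shows "\<sigma> a \<in> graded_part {k..}"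
proof -
  have "\<sigma> a - a \<in> graded_part {k..}"
    by (rule graded_part_mono[OF Gamma_diff[OF assms]]) auto
  from graded_part_add[OF this assms(2)] show ?thesis
    by simp
qed

text \<open>
  Degree by degree: if \<open>a\<close> starts in degree \<open>l\<close>, then \<open>\<sigma> a - a\<close> starts in degree \<open>l + 2\<close>, so \<open>a\<close>
  agrees with \<open>\<sigma> a\<close> in degree \<open>l\<close>.
\<close>

lemma Gamma_filtration_reflect:
  assumes \<sigma>: "\<sigma> \<in> carrier Gamma" and "\<sigma> a \<in> graded_part {k..}"
  shows "a \<in> graded_part {k..}"
proof -
  have "a \<in> graded_part {l..}" if "l \<le> k" for l
    using that
  proof (induction l)
    case 0
    have "{0::nat..} = UNIV"
      by auto
    then show ?case
      by simp
  next
    case (Suc l)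
    then have "\<sigma> a - a \<in> graded_part {l + 2..}"
      by (intro Gamma_diff[OF \<sigma>]) simp
    then have "\<sigma> a - a \<in> graded_part {Suc l..}"
      by (rule graded_part_mono) auto
    moreover have "\<sigma> a \<in> graded_part {Suc l..}"
      by (rule graded_part_mono[OF assms(2)]) (use Suc.prems in auto)
    ultimately show ?case
      using graded_part_diff[of "\<sigma> a" "{Suc l..}" "\<sigma> a - a"] by simp
  qed
  then show ?thesis
    by simp
qed

text \<open>Since \<open>\<sigma>\<close> preserves parity, the image of the even part of
  \<open>a\<close> is both even and odd, hence 0; injectivity then kills the even part.\<close>

lemma Gamma_odd_reflect:
  assumes \<sigma>: "\<sigma> \<in> carrier Gamma" and odd: "\<sigma> a \<in> odd_elements"
  shows "a \<in> odd_elements"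
proof -
  note hom = Gamma_hom[OF \<sigma>]
  let ?a0 = "proj {d. even d} a" and ?a1 = "proj {d. odd d} a"
  have "- {d. odd d} = {d::nat. even d}"
    by auto
  then have a: "a = ?a1 + ?a0"
    using proj_Compl[of "{d. odd d}" a] by simp
  have "\<sigma> ?a0 = \<sigma> a - \<sigma> ?a1"
    by (subst (2) a) (simp add: algebra_hom_simps[OF hom])
  also have "\<dots> \<in> odd_elements"
    by (intro graded_part_diff odd algebra_hom_odd[OF hom Gamma_gen_odd[OF \<sigma>]] proj_in_graded_part)
  finally have "\<sigma> ?a0 \<in> odd_elements" .
  moreover have "\<sigma> ?a0 \<in> even_elements"
    by (intro algebra_hom_even[OF hom Gamma_gen_odd[OF \<sigma>]] proj_in_graded_part)
  ultimately have "\<sigma> ?a0 \<in> graded_part ({d. odd d} \<inter> {d. even d})"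
    by (rule graded_part_Int)
  then have "\<sigma> ?a0 = 0"
    by (induction rule: graded_part_induct) auto
  then have "\<sigma> ?a0 = \<sigma> 0"
    by (simp add: algebra_hom_simps[OF hom])
  then have "?a0 = 0"
    using bij_is_inj[OF Gamma_bij[OF \<sigma>]] by (simp add: inj_eq)
  then show ?thesis
    using a proj_in_graded_part[of "{d. odd d}" a] by simp
qed

lemma Gamma_compose:
  assumes \<sigma>: "\<sigma> \<in> carrier Gamma" and \<tau>: "\<tau> \<in> carrier Gamma"
  shows "\<sigma> \<circ> \<tau> \<in> carrier Gamma"
proof -
  have diff: "(\<sigma> \<circ> \<tau>) (gen i) - gen i = \<sigma> (\<tau> (gen i) - gen i) + (\<sigma> (gen i) - gen i)" for i
    by (simp add: algebra_hom_simps[OF Gamma_hom[OF \<sigma>]])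
  have "(\<sigma> \<circ> \<tau>) (gen i) - gen i \<in> odd_elements" for i
    unfolding diff
    by (intro graded_part_add algebra_hom_odd[OF Gamma_hom[OF \<sigma>] Gamma_gen_odd[OF \<sigma>]]
        Gamma_diff_odd \<sigma> \<tau>)
  moreover have "(\<sigma> \<circ> \<tau>) (gen i) - gen i \<in> graded_part {3..}" for i
    unfolding diff by (intro graded_part_add Gamma_filtration[OF \<sigma>] Gamma_diff_cubed \<sigma> \<tau>)
  ultimately show ?thesis
    unfolding Gamma_iff
    by (simp add: bij_comp Gamma_bij algebra_hom_compose Gamma_hom \<sigma> \<tau> del: comp_apply)
qed

text \<open>The map \<open>\<sigma>\<close> sends the deviation of its inverse on a generator to
  minus its own deviation there. The two reflection lemmas pull oddness and the degree bound
  back.\<close>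

lemma Gamma_inverse:
  assumes \<sigma>: "\<sigma> \<in> carrier Gamma"
  shows "inv_into UNIV \<sigma> \<in> carrier Gamma"
proof -
  let ?\<tau> = "inv_into UNIV \<sigma>"
  have hom: "algebra_hom ?\<tau>"
    by (rule algebra_hom_inv[OF Gamma_hom[OF \<sigma>] Gamma_bij[OF \<sigma>]])
  have "\<sigma> (?\<tau> a) = a" for a
    using bij_is_surj[OF Gamma_bij[OF \<sigma>]] by (simp add: surj_f_inv_f)
  then have diff: "\<sigma> (?\<tau> (gen i) - gen i) = - (\<sigma> (gen i) - gen i)" for i
    by (simp add: algebra_hom_simps[OF Gamma_hom[OF \<sigma>]])
  have "?\<tau> (gen i) - gen i \<in> odd_elements" for i
    by (rule Gamma_odd_reflect[OF \<sigma>]) (simp only: diff graded_part_minus Gamma_diff_odd[OF \<sigma>])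
  moreover have "?\<tau> (gen i) - gen i \<in> graded_part {3..}" for i
    by (rule Gamma_filtration_reflect[OF \<sigma>]) (simp only: diff graded_part_minus Gamma_diff_cubed[OF \<sigma>])
  ultimately show ?thesis
    unfolding Gamma_iff using hom bij_imp_bij_inv[OF Gamma_bij[OF \<sigma>]] by simp
qed

lemma Gamma_inverse_left: "\<sigma> \<in> carrier Gamma \<Longrightarrow> inv_into UNIV \<sigma> \<circ> \<sigma> = id"
  by (rule inv_o_cancel[OF bij_is_inj[OF Gamma_bij]])

lemma id_in_Gamma: "id \<in> carrier Gamma"
  by (simp add: Gamma_iff algebra_hom_id)

lemma group_Gamma: "group Gamma"
proof (rule groupI)
  show "\<exists>\<tau>\<in>carrier Gamma. \<tau> \<otimes>\<^bsub>Gamma\<^esub> \<sigma> = \<one>\<^bsub>Gamma\<^esub>" if "\<sigma> \<in> carrier Gamma"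
    for \<sigma> :: "('a, 'b) grassmann \<Rightarrow> ('a, 'b) grassmann"
    using that Gamma_inverse Gamma_inverse_left by (metis Gamma_mult Gamma_one)
qed (simp_all add: Gamma_compose id_in_Gamma comp_assoc)

lemma Gamma_inv_eq:
  assumes \<sigma>: "\<sigma> \<in> carrier Gamma"
  shows "inv\<^bsub>Gamma\<^esub> \<sigma> = inv_into UNIV \<sigma>"
  by (rule group.inv_equality[OF group_Gamma])
    (simp_all add: Gamma_inverse_left Gamma_inverse \<sigma>)

section \<open>The Jacobian group\<close>

lemma Jacobian_compose_Gamma:
  assumes "\<sigma> \<in> carrier Gamma" "\<tau> \<in> carrier Gamma"
  shows "Jacobian (\<sigma> \<circ> \<tau>) = \<sigma> (Jacobian \<tau>) * Jacobian \<sigma>"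
  by (rule Jacobian_compose) (simp_all add: Gamma_hom Gamma_gen_odd assms)

lemma Jacobian_id: "Jacobian id = 1"
proof -
  have "Jacobian id = partial j (id (gen j))" for j
    unfolding Jacobian_def by (rule leibniz_det_single_row) (simp add: partial_gen)
  then show ?thesis
    by (simp add: partial_gen)
qed

lemma subgroup_Jacobian_group: "subgroup Jacobian_group Gamma"
proof (rule group.subgroupI[OF group_Gamma])
  show "Jacobian_group \<subseteq> carrier Gamma"
    by (auto simp: Jacobian_group_def)
  show "Jacobian_group \<noteq> {}"
    using id_in_Gamma Jacobian_id by (auto simp: Jacobian_group_def)
next
  fix \<sigma> :: "('a, 'b) grassmann \<Rightarrow> ('a, 'b) grassmann"
  assume "\<sigma> \<in> Jacobian_group"
  then have \<sigma>: "\<sigma> \<in> carrier Gamma" "Jacobian \<sigma> = 1"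
    by (simp_all add: Jacobian_group_def)
  let ?\<tau> = "inv_into UNIV \<sigma>"
  have \<tau>: "?\<tau> \<in> carrier Gamma"
    by (rule Gamma_inverse[OF \<sigma>(1)])
  \<comment> \<open>The chain rule for \<open>?\<tau> \<circ> \<sigma> = id\<close>.\<close>
  have "1 = ?\<tau> (Jacobian \<sigma>) * Jacobian ?\<tau>"
    by (simp add: Gamma_inverse_left[OF \<sigma>(1)] Jacobian_id flip: Jacobian_compose_Gamma[OF \<tau> \<sigma>(1)])
  then have "Jacobian ?\<tau> = 1"
    by (simp add: \<sigma>(2) algebra_hom_1[OF Gamma_hom[OF \<tau>]])
  with \<sigma> \<tau> show "inv\<^bsub>Gamma\<^esub> \<sigma> \<in> Jacobian_group"
    by (simp add: Jacobian_group_def Gamma_inv_eq)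
next
  fix \<sigma> \<tau> :: "('a, 'b) grassmann \<Rightarrow> ('a, 'b) grassmann"
  assume "\<sigma> \<in> Jacobian_group" "\<tau> \<in> Jacobian_group"
  then show "\<sigma> \<otimes>\<^bsub>Gamma\<^esub> \<tau> \<in> Jacobian_group"
    by (simp add: Jacobian_group_def Gamma_compose Jacobian_compose_Gamma algebra_hom_1[OF Gamma_hom])
qed

lemma Gamma_commute:
  fixes \<sigma> :: "('k::comm_ring_1, 'n::finite) grassmann \<Rightarrow> ('k, 'n) grassmann"
  assumes "CARD('n) \<le> 4" and \<sigma>: "\<sigma> \<in> carrier Gamma" and \<tau>: "\<tau> \<in> carrier Gamma"
  shows "\<sigma> \<circ> \<tau> = \<tau> \<circ> \<sigma>"
proof (rule algebra_hom_ext)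
  have "\<sigma> (\<tau> (gen i)) = \<sigma> (gen i) + \<tau> (gen i) - gen i"
    if \<sigma>: "\<sigma> \<in> carrier Gamma" and \<tau>: "\<tau> \<in> carrier Gamma"
    for \<sigma> \<tau> :: "('k, 'n) grassmann \<Rightarrow> ('k, 'n) grassmann" and i
  proof -
    \<comment> \<open>The deviation of \<open>\<tau>\<close> starts in degree 3, so
      \<open>\<sigma>\<close> changes it only from degree 5 on, where everything is 0.\<close>
    have "\<sigma> (\<tau> (gen i) - gen i) - (\<tau> (gen i) - gen i) = 0"
      by (rule graded_part_above_card[OF Gamma_diff[OF \<sigma> Gamma_diff_cubed[OF \<tau>]]])
        (use assms(1) in auto)
    then show ?thesis
      by (simp add: algebra_hom_simps[OF Gamma_hom[OF \<sigma>]] algebra_simps)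
  qed
  \<comment> \<open>The formula is symmetric in the two automorphisms.\<close>
  from this[OF \<sigma> \<tau>] this[OF \<tau> \<sigma>] show "(\<sigma> \<circ> \<tau>) (gen i) = (\<tau> \<circ> \<sigma>) (gen i)" for i
    by (simp add: add.commute)
qed (simp_all add: algebra_hom_compose Gamma_hom \<sigma> \<tau>)

section \<open>Elementary automorphisms\<close>

definition shear ::
    "'n \<Rightarrow> ('k::comm_ring_1, 'n) grassmann \<Rightarrow> ('k, 'n) grassmann \<Rightarrow> ('k, 'n) grassmann" where
  "shear k b = endomorphism (\<lambda>i. if i = k then gen k + b else gen i)"

lemma shear_hom:
  assumes "b \<in> odd_elements"
  shows "algebra_hom (shear k b)" "shear k b (gen i) = (if i = k then gen k + b else gen i)"
proof -
  have odd: "(if i = k then gen k + b else gen i) \<in> odd_elements" for i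
    using assms by (simp add: gen_odd graded_part_add)
  show "algebra_hom (shear k b)" "shear k b (gen i) = (if i = k then gen k + b else gen i)"
    unfolding shear_def by (rule endomorphism_hom[OF odd])+
qed

lemma shear_mon_notin:
  assumes b: "b \<in> odd_elements" and "k \<notin> set w"
  shows "shear k b (mon w) = mon w"
  using assms(2) by (induction w) (auto simp: algebra_hom_simps[OF shear_hom(1)[OF b]] shear_hom(2)[OF b])

lemma shear_mon_Cons:
  assumes b: "b \<in> odd_elements" and "k \<notin> set w"
  shows "shear k b (mon (k # w)) = mon (k # w) + b * mon w"
  by (simp add: algebra_hom_mult[OF shear_hom(1)[OF b]] shear_hom(2)[OF b] shear_mon_notin assms
      distrib_right)

text \<open>As \<open>b\<close> is fixed, the composite sends the generator at \<open>k\<close> to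
  itself plus \<open>b\<close> minus \<open>b\<close>.\<close>

lemma shear_inverse:
  assumes b: "b \<in> odd_elements" and fixed: "shear k b b = b"
  shows "shear k b \<circ> shear k (- b) = id"
proof (rule algebra_hom_ext)
  show "algebra_hom (shear k b \<circ> shear k (- b))"
    by (intro algebra_hom_compose shear_hom graded_part_minus b)
  show "(shear k b \<circ> shear k (- b)) (gen i) = id (gen i)" for i
    using fixed
    by (simp add: shear_hom(2) graded_part_minus b algebra_hom_simps[OF shear_hom(1)[OF b]])
qed (rule algebra_hom_id)

lemma shear_in_Gamma:
  assumes b: "b \<in> odd_elements" "b \<in> graded_part {3..}"
    and fixed: "shear k b b = b" "shear k (- b) b = b"
  shows "shear k b \<in> carrier Gamma"
proof -
  have b': "- b \<in> odd_elements"
    using b by (simp add: graded_part_minus)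
  \<comment> \<open>With \<open>- b\<close> in the role of \<open>b\<close>, the inverse lemma also
    covers the composite in the other order, which gives bijectivity.\<close>
  have "shear k (- b) (- b) = - b"
    using fixed(2) by (simp add: algebra_hom_simps[OF shear_hom(1)[OF b']])
  from shear_inverse[OF b' this] shear_inverse[OF b(1) fixed(1)] have "bij (shear k b)"
    by (simp add: o_bij)
  then show ?thesis
    using b by (simp add: Gamma_iff shear_hom)
qed

lemma Jacobian_shear:
  assumes "b \<in> odd_elements"
  shows "Jacobian (shear k b) = 1 + partial k b"
proof -
  have "Jacobian (shear k b) = partial k (shear k b (gen k))"
    unfolding Jacobian_def by (rule leibniz_det_single_row) (simp add: shear_hom[OF assms] partial_gen)
  then show ?thesis
    by (simp add: shear_hom[OF assms] K_linear_simps[OF K_linear_partial] partial_gen)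
qed

lemma partial_mon_notin:
  assumes "i \<notin> set w"
  shows "partial i (mon w) = 0"
  using assms by (induction w) (auto simp: partial_gen_mult)

text \<open>Differentiating by the first letter recovers the shorter monomial, so the claim descends
  to \<open>1 \<noteq> 0\<close>.\<close>

lemma mon_distinct_nonzero:
  assumes "distinct w"
  shows "mon w \<noteq> (0 :: ('k::comm_ring_1, 'n) grassmann)"
  using assms
proof (induction w)
  case (Cons i w)
  have "partial i (mon (i # w) :: ('k, 'n) grassmann) = mon w"
    using Cons.prems by (simp add: partial_gen_mult partial_mon_notin)
  with Cons show ?case
    by (metis K_linear_0 K_linear_partial distinct.simps(2))
qed simp

section \<open>The counterexample in at least five generators\<close>

lemma Jacobian_group_not_normal:
  assumes "CARD('n) \<ge> 5"
  shows "\<not> (Jacobian_group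
             :: (('k::comm_ring_1, 'n::{finite,linorder}) grassmann \<Rightarrow> ('k, 'n) grassmann) set) \<lhd> Gamma"
proof
  assume normal: "(Jacobian_group :: (('k, 'n) grassmann \<Rightarrow> ('k, 'n) grassmann) set) \<lhd> Gamma"
  obtain xs :: "'n list" where "set xs = UNIV" "distinct xs"
    using finite_distinct_list[of "UNIV :: 'n set"] by auto
  then have "distinct (take 5 xs)" "length (take 5 xs) = 5"
    using assms distinct_card[of xs] by simp_all
  \<comment> \<open>The indices \<open>p\<close>, \<open>q\<close>, \<open>r\<close>,
    \<open>s\<close>, \<open>t\<close> play the roles of 1 to 5 in the outline.\<close>
  then obtain p q r s t :: 'n where distinct: "distinct [p, q, r, s, t]"
    by (auto simp: length_Suc_conv numeral_eq_Suc simp del: length_take)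
  define b :: "('k, 'n) grassmann" where "b = mon [p, s, t]"
  define c :: "('k, 'n) grassmann" where "c = mon [p, q, r]"
  let ?\<sigma> = "shear q b" and ?\<tau> = "shear p c"
  have b: "b \<in> odd_elements" "b \<in> graded_part {3..}" and c: "c \<in> odd_elements" "c \<in> graded_part {3..}"
    unfolding b_def c_def by (intro graded_part_mon; simp)+
  \<comment> \<open>The generator at \<open>q\<close> does not occur in \<open>b\<close>, so every
    shear at \<open>q\<close> fixes \<open>b\<close>, and \<open>partial q b\<close> is 0
    below.\<close>
  have \<sigma>_fixed: "shear q d b = b" if "d \<in> odd_elements" for d
    unfolding b_def by (rule shear_mon_notin[OF that]) (use distinct in auto)
  have \<sigma>: "?\<sigma> \<in> carrier Gamma"
    by (intro shear_in_Gamma \<sigma>_fixed graded_part_minus b)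
  have J\<sigma>: "Jacobian ?\<sigma> = 1"
    unfolding Jacobian_shear[OF b(1)] unfolding b_def using distinct by (subst partial_mon_notin) auto
  \<comment> \<open>Here \<open>c\<close> does contain the sheared generator; a shear by
    \<open>c\<close> or \<open>- c\<close> changes \<open>c\<close> by plus or minus this product,
    which repeats letters.\<close>
  have "c * mon [q, r] = 0"
    unfolding c_def mon_append[symmetric] by (rule mon_not_distinct) simp
  then have \<tau>_fixed: "shear p d c = c" if "d \<in> odd_elements" "d = c \<or> d = - c" for d
    using that(2) shear_mon_Cons[OF that(1), of p "[q, r]"] distinct unfolding c_def[symmetric] by auto
  have \<tau>: "?\<tau> \<in> carrier Gamma"
    by (intro shear_in_Gamma \<tau>_fixed graded_part_minus c; simp)
  have J\<tau>: "Jacobian ?\<tau> = 1 + mon [q, r]"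
  proof -
    have "partial p (mon [q, r] :: ('k, 'n) grassmann) = 0"
      by (rule partial_mon_notin) (use distinct in auto)
    then have "partial p c = mon [q, r]"
      unfolding c_def mon_Cons[of p] partial_gen_mult by simp
    then show ?thesis
      unfolding Jacobian_shear[OF c(1)] by (rule arg_cong)
  qed
  \<comment> \<open>Equality of left and right cosets moves \<open>?\<tau>\<close> to the front and
    replaces \<open>?\<sigma>\<close> by some \<open>\<rho>\<close> in the Jacobian group.\<close>
  have "?\<sigma> \<circ> ?\<tau> \<in> Jacobian_group #>\<^bsub>Gamma\<^esub> ?\<tau>"
    using \<sigma> J\<sigma> by (auto simp: r_coset_def Jacobian_group_def)
  also have "\<dots> = ?\<tau> <#\<^bsub>Gamma\<^esub> Jacobian_group"
    using normal.coset_eq[OF normal] \<tau> by blast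
  finally obtain \<rho> where \<rho>: "\<rho> \<in> carrier Gamma" "Jacobian \<rho> = 1" and eq: "?\<sigma> \<circ> ?\<tau> = ?\<tau> \<circ> \<rho>"
    unfolding l_coset_def Jacobian_group_def Gamma_mult by blast
  have "?\<sigma> (Jacobian ?\<tau>) = Jacobian (?\<sigma> \<circ> ?\<tau>)"
    by (simp add: Jacobian_compose_Gamma[OF \<sigma> \<tau>] J\<sigma>)
  also have "\<dots> = Jacobian ?\<tau>"
    unfolding eq by (simp add: Jacobian_compose_Gamma[OF \<tau> \<rho>(1)] \<rho>(2) algebra_hom_1[OF Gamma_hom[OF \<tau>]])
  finally have "?\<sigma> (mon [q, r]) = mon [q, r]"
    unfolding J\<tau> by (simp add: algebra_hom_1 K_linear_add algebra_hom_linear Gamma_hom[OF \<sigma>] del: mon_Cons)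
  moreover have "?\<sigma> (mon [q, r]) = mon [q, r] + b * mon [r]"
    by (rule shear_mon_Cons[OF b(1)]) (use distinct in auto)
  moreover have "b * mon [r] = mon [p, s, t, r]"
    unfolding b_def mon_append[symmetric] by simp
  ultimately have "mon [p, s, t, r] = (0 :: ('k, 'n) grassmann)"
    by simp
  moreover have "distinct [p, s, t, r]"
    using distinct by auto
  ultimately show False
    using mon_distinct_nonzero by blast
qed

theorem corollary4p13:
  assumes "CARD('n) \<ge> 4"
  shows "\<not> (Jacobian_group
             :: (('k::comm_ring_1, 'n::{finite,linorder}) grassmann \<Rightarrow> ('k, 'n) grassmann) set) \<lhd> Gamma
         \<longleftrightarrow> CARD('n) \<ge> 5"
proof (cases "CARD('n) \<ge> 5")
  case True
  then show ?thesis
    using Jacobian_group_not_normal by blast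
next
  case False
  \<comment> \<open>At most four generators remain, so \<open>Gamma_commute\<close> applies and
    every subgroup is normal.\<close>
  then have "comm_group (Gamma :: (('k, 'n) grassmann \<Rightarrow> ('k, 'n) grassmann) monoid)"
    by (intro group.group_comm_groupI[OF group_Gamma]) (auto intro: Gamma_commute)
  then have "(Jacobian_group :: (('k, 'n) grassmann \<Rightarrow> ('k, 'n) grassmann) set) \<lhd> Gamma"
    using comm_group.subgroup_imp_normal subgroup_Jacobian_group by blast
  with False show ?thesis
    by blast
qed

end
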